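(* Let $p$ be a prime and let $\alpha$ be a non-zero algebraic number with $|\alpha|<1$. Let \[ T_p(z)=\prod_{j=1}^{\infty}\left(1-z^{p^{j}}\right)^{-1/p^{j}} . \] Then the value $T_p(\alpha)$ is transcendental over $\overline{\mathbb{Q}}$.
   Context: For $|z|<1$, each factor $(1-z^{p^j})^{-1/p^j}$ is defined using the principal branch (equivalently, $T_p(z)=\exp\bigl(-\sum_{j\ge1}p^{-j}\log(1-z^{p^j})\bigr)$ with the principal logarithm); the product converges absolutely and defines an analytic function on the open unit disk $|z|<1$. *)

theory Defs
  imports "HOL-Analysis.Analysis" "HOL-Computational_Algebra.Polynomial"
begin

text \<open>T_p(z) = prod_{j>=1} (1 - z^(p^j))^(-1/p^j), principal branch, i.e.
  exp(- sum_{j>=1} p^(-j) Log(1 - z^(p^j))) for |z| < 1.\<close>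
definition T :: "nat \<Rightarrow> complex \<Rightarrow> complex" where
  "T p z = exp (- (\<Sum>j. (1 / of_nat (p ^ Suc j)) * Ln (1 - z ^ (p ^ Suc j))))"

end

theory Submission
  imports Defs "HOL-Complex_Analysis.Complex_Analysis"
    "HOL-Computational_Algebra.Polynomial_Factorial" "HOL-Real_Asymp.Real_Asymp"
begin

unbundle no vec_syntax

text \<open>
  Mahler's method. The function \<open>T = T p\<close> satisfies \<open>T (z^p) = (1 - z^p) * T z ^ p\<close>, and
  \<open>F x = T (p^2 * x)\<close> has integer Taylor coefficients. Suppose \<open>T \<alpha>\<close> is algebraic. Iterating the
  functional equation, the value \<open>T (\<alpha>^(p^k))\<close> has logarithmic height of order \<open>k * p^k\<close> rather
  than \<open>p^k\<close>, so a single auxiliary polynomial is not enough. Instead, Siegel's lemma gives for every \<open>k\<close> a polynomial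
  \<open>P k\<close> of degree \<open>< 2l\<close> in \<open>y\<close> and \<open>< 2lk\<close> in \<open>x\<close> such that \<open>P k (x, F x)\<close> vanishes at \<open>0\<close> to
  order at least \<open>2 * l^2 * k\<close>. For \<open>l\<close> large, Liouville's inequality forces \<open>P k\<close> to vanish at
  \<open>x = \<alpha>^(p^k) / p^2\<close>, \<open>y = T (\<alpha>^(p^k))\<close> for all large \<open>k\<close>. An integer power series vanishing at
  such a small point has order at least a constant times \<open>p^k\<close>, which is far more than the degrees of
  \<open>P k\<close> allow for two coprime polynomials. So suitable prime factors of \<open>P k\<close> and \<open>P (k + 1)\<close>
  coincide up to units for all large \<open>k\<close>, and this common factor vanishes to infinite order at \<open>(x, F x)\<close>,
  contradicting the transcendence of the function \<open>T\<close>.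
\<close>

section \<open>Siegel's lemma and a Liouville inequality for two algebraic numbers\<close>

text \<open>The additional factor \<open>k\<close> in the height comes from the factors
  \<open>1 - \<alpha> ^ (p ^ i)\<close>, \<open>i \<le> k\<close>, of the iterated functional
  equation: raised to the power \<open>p ^ (k - i)\<close>, each has degree \<open>p ^ k\<close> in
  \<alpha>. The length of such an expression still has a logarithm of order \<open>p ^ k\<close>, so
  only the degree is critical. Since the auxiliary polynomial changes with \<open>k\<close>, the
  identity theorem for one fixed function cannot guarantee a non-zero value. The argument therefore
  accepts the vanishing and draws its contradiction from it. For this the degree in \<open>y\<close>
  must not depend on \<open>k\<close>: eliminating \<open>y\<close> costs a factor exponential in
  that degree. With this factor constant, the order needed is only quadratic in \<open>k\<close>.
  The denominators of the Taylor coefficients of \<open>T\<close> are powers of \<open>p\<close>.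
  Scaling by \<open>p ^ 2\<close> removes them for every \<open>p\<close>: the functional equation
  of \<open>F\<close> contains \<open>p ^ (2 * p - 2)\<close>, a multiple of \<open>p ^ 2\<close>
  even for \<open>p = 2\<close>. Heights and number fields are replaced by degree and length of
  integer polynomials evaluated at \<alpha> and \<open>T p \<alpha>\<close>.\<close>

lemma siegel_lemma:
  fixes c :: "'e \<Rightarrow> 'u \<Rightarrow> int" and A :: nat
  assumes U: "finite U" "U \<noteq> {}" and E: "finite E" and card: "2 * card E \<le> card U"
    and c: "\<And>e u. e \<in> E \<Longrightarrow> u \<in> U \<Longrightarrow> \<bar>c e u\<bar> \<le> int A" and A: "A \<ge> 1"
  obtains x :: "'u \<Rightarrow> int" where "\<exists>u\<in>U. x u \<noteq> 0" "\<And>u. u \<in> U \<Longrightarrow> \<bar>x u\<bar> \<le> int (2 * card U * A)"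
    "\<And>e. e \<in> E \<Longrightarrow> (\<Sum>u\<in>U. c e u * x u) = 0"
proof -
  \<comment> \<open>Pigeonhole on the box \<open>X\<close>. This \<open>B\<close> makes the interval
    \<open>{- M..M}\<close> consist of \<open>B ^ 2 + 1 < (B + 1) ^ 2\<close> integers, so having
    twice as many unknowns as equations gives \<open>card Y < card X\<close>.\<close>
  define B where "B = 2 * card U * A"
  define X where "X = (U \<rightarrow>\<^sub>E {0..int B})"
  define M where "M = int (card U * A * B)"
  define Y where "Y = (E \<rightarrow>\<^sub>E {- M..M})"
  define \<Phi> where "\<Phi> = (\<lambda>x. \<lambda>e\<in>E. \<Sum>u\<in>U. c e u * x u)"
  have cU: "card U \<ge> 1" using U by (simp add: Suc_leI card_gt_0_iff)
  have cX: "card X = (B + 1) ^ card U"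
    unfolding X_def using U by (simp add: card_PiE nat_add_distrib)
  have cY: "card Y = (2 * (card U * A * B) + 1) ^ card E"
    unfolding Y_def M_def using E by (simp add: card_PiE nat_add_distrib nat_mult_distrib ac_simps)
  have finY: "finite Y" unfolding Y_def using E by (intro finite_PiE) auto
  have "(2 * (card U * A * B) + 1) ^ card E < ((B + 1)\<^sup>2) ^ card E \<or> card E = 0"
  proof (cases "card E = 0")
    case False
    have "2 * (card U * A * B) + 1 < (B + 1)\<^sup>2"
      using cU A by (simp add: B_def power2_eq_square algebra_simps)
    thus ?thesis using False by (intro disjI1 power_strict_mono) auto
  qed auto
  moreover have "B > 0" using cU A by (simp add: B_def)
  ultimately have "(2 * (card U * A * B) + 1) ^ card E < (B + 1) ^ card U"
  proof (elim disjE)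
    assume "(2 * (card U * A * B) + 1) ^ card E < ((B + 1)\<^sup>2) ^ card E"
    also have "\<dots> = (B + 1) ^ (2 * card E)" by (simp add: power_mult)
    also have "\<dots> \<le> (B + 1) ^ card U" using card by (intro power_increasing) auto
    finally show ?thesis .
  next
    assume "card E = 0"
    have "1 < (B + 1) ^ card U" using \<open>B > 0\<close> cU by (intro one_less_power) auto
    thus ?thesis using \<open>card E = 0\<close> by simp
  qed
  hence "card Y < card X" using cX cY by simp
  moreover have "\<Phi> ` X \<subseteq> Y"
  proof
    fix y assume "y \<in> \<Phi> ` X"
    then obtain x where x: "x \<in> X" "y = \<Phi> x" by auto
    have "\<bar>\<Sum>u\<in>U. c e u * x u\<bar> \<le> M" if "e \<in> E" for e
    proof -
      have "\<bar>\<Sum>u\<in>U. c e u * x u\<bar> \<le> (\<Sum>u\<in>U. \<bar>c e u * x u\<bar>)" by (rule sum_abs)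
      also have "\<dots> \<le> (\<Sum>u\<in>U. int A * int B)"
      proof (intro sum_mono)
        fix u assume u: "u \<in> U"
        hence "x u \<in> {0..int B}" using x by (auto simp: X_def)
        thus "\<bar>c e u * x u\<bar> \<le> int A * int B"
          using c[OF that u] by (simp add: abs_mult mult_mono)
      qed
      also have "\<dots> = M" by (simp add: M_def)
      finally show ?thesis .
    qed
    thus "y \<in> Y" unfolding x(2) Y_def \<Phi>_def by (force simp: abs_le_iff)
  qed
  ultimately have "\<not> inj_on \<Phi> X"
    using finY by (metis card_image card_mono not_le)
  then obtain x y where xy: "x \<in> X" "y \<in> X" "\<Phi> x = \<Phi> y" "x \<noteq> y"
    unfolding inj_on_def by blast
  show ?thesis
  proof
    show "\<exists>u\<in>U. x u - y u \<noteq> 0"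
    proof (rule ccontr)
      assume "\<not> ?thesis"
      hence "x u = y u" for u using xy(1,2) unfolding X_def by (cases "u \<in> U") (auto simp: PiE_def extensional_def)
      thus False using xy(4) by auto
    qed
    show "\<bar>x u - y u\<bar> \<le> int (2 * card U * A)" if "u \<in> U" for u
    proof -
      have "x u \<in> {0..int B}" "y u \<in> {0..int B}" using xy that by (auto simp: X_def)
      thus ?thesis by (auto simp: B_def)
    qed
    show "(\<Sum>u\<in>U. c e u * (x u - y u)) = 0" if "e \<in> E" for e
      using fun_cong[OF xy(3), of e] that
      by (simp add: \<Phi>_def right_diff_distrib sum_subtractf)
  qed
qed

text \<open>A number is \<open>rep a b d S\<close> if it is the value at \<open>(a, b)\<close>
  of an integer polynomial of degree at most \<open>d\<close> and length (sum of absolute coefficients) at most \<open>S\<close>.\<close>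
inductive rep :: "complex \<Rightarrow> complex \<Rightarrow> nat \<Rightarrow> nat \<Rightarrow> complex \<Rightarrow> bool" for a b :: complex where
  rep_zero: "rep a b d S 0"
| rep_step: "rep a b d S x \<Longrightarrow> s \<in> {1, -1} \<Longrightarrow> i + j \<le> d \<Longrightarrow> rep a b d (Suc S) (x + s * a ^ i * b ^ j)"

lemma rep_mono: "rep a b d S x \<Longrightarrow> d \<le> d' \<Longrightarrow> S \<le> S' \<Longrightarrow> rep a b d' S' x"
proof (induction arbitrary: S' rule: rep.induct)
  case (rep_step d S x s i j)
  obtain S'' where "S' = Suc S''" "S \<le> S''" using rep_step by (cases S') auto
  thus ?case using rep_step by (auto intro!: rep.rep_step)
qed (auto intro: rep.intros)

lemma rep_add: "rep a b d S x \<Longrightarrow> rep a b d S' y \<Longrightarrow> rep a b d (S + S') (x + y)"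
proof (induction rule: rep.induct)
  case (rep_zero d S)
  thus ?case by (auto intro: rep_mono)
next
  case (rep_step d S x s i j)
  have "rep a b d (Suc (S + S')) ((x + y) + s * a ^ i * b ^ j)"
    using rep_step by (intro rep.rep_step) auto
  thus ?case by (simp add: algebra_simps)
qed

lemma rep_monomial: "s \<in> {1, -1} \<Longrightarrow> i + j \<le> d \<Longrightarrow> rep a b d 1 (s * a ^ i * b ^ j)"
  using rep_step[OF rep_zero[of a b d 0], of s i j] by simp

lemma rep_mult_monomial:
  "rep a b d S x \<Longrightarrow> s \<in> {1, -1} \<Longrightarrow> i + j \<le> d' \<Longrightarrow> rep a b (d + d') S (x * (s * a ^ i * b ^ j))"
proof (induction rule: rep.induct)
  case (rep_zero d S)
  thus ?case by (auto intro: rep.intros)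
next
  case (rep_step d S x t k l)
  have "rep a b (d + d') (Suc S) (x * (s * a ^ i * b ^ j) + (s * t) * a ^ (i + k) * b ^ (j + l))"
    using rep_step by (intro rep.rep_step) auto
  thus ?case by (simp add: algebra_simps power_add)
qed

lemma rep_mult: "rep a b d S x \<Longrightarrow> rep a b d' S' y \<Longrightarrow> rep a b (d + d') (S * S') (x * y)"
proof (induction rule: rep.induct)
  case (rep_zero d S)
  thus ?case by (auto intro: rep.intros)
next
  case (rep_step d S x s i j)
  have "rep a b (d' + d) S' (y * (s * a ^ i * b ^ j))"
    using rep_step by (intro rep_mult_monomial) auto
  hence "rep a b (d + d') (S * S' + S') (x * y + y * (s * a ^ i * b ^ j))"
    using rep_step by (intro rep_add) (auto simp: add.commute)
  thus ?case by (simp add: algebra_simps)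
qed

lemma rep_power: "rep a b d S x \<Longrightarrow> rep a b (n * d) (S ^ n) (x ^ n)"
proof (induction n)
  case 0
  show ?case using rep_monomial[of 1 0 0 0 a b] by simp
next
  case (Suc n)
  thus ?case using rep_mult[of a b d S x "n * d" "S ^ n" "x ^ n"] by simp
qed

lemma rep_of_int: "rep a b 0 (nat \<bar>n\<bar>) (of_int n)"
proof -
  have *: "s \<in> {1, -1} \<Longrightarrow> rep a b 0 k (s * of_nat k)" for k s
  proof (induction k)
    case (Suc k)
    show ?case using rep.rep_step[OF Suc.IH, of s 0 0] Suc.prems by (simp add: algebra_simps)
  qed (auto intro: rep.intros)
  show ?thesis
    using *[of 1 "nat n"] *[of "-1" "nat (-n)"] by (cases "n \<ge> 0") (auto simp: of_nat_nat)
qed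

lemma rep_sum:
  assumes "finite I" "\<And>i. i \<in> I \<Longrightarrow> rep a b d (S i) (f i)"
  shows "rep a b d (sum S I) (sum f I)"
  using assms by (induction I rule: finite_induct) (auto intro: rep_add rep_zero)

text \<open>Each reduction of \<open>a ^ m\<close> by an integer equation for \<open>a\<close> is
  paid for with one factor \<open>q\<close>, the absolute leading coefficient. The coordinates then
  grow only exponentially in \<open>d\<close>, and \<open>m\<close>, \<open>q\<close>,
  \<open>C\<close> depend on \<open>a\<close> alone.\<close>

lemma algebraic_power_coordinates:
  fixes a :: complex
  assumes "algebraic a"
  obtains m q C :: nat where "q \<ge> 1" "C \<ge> 1"
    "\<And>e d. e \<le> d \<Longrightarrow> \<exists>c :: nat \<Rightarrow> int. of_nat q ^ d * a ^ e = (\<Sum>i<m. of_int (c i) * a ^ i) \<and>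
        (\<forall>i<m. \<bar>c i\<bar> \<le> int C ^ d)"
proof -
  obtain p0 where p0: "\<And>i. coeff p0 i \<in> \<int>" "p0 \<noteq> 0" "poly p0 a = 0"
    by (rule algebraicE[OF assms]) blast
  define m where "m = degree p0"
  define r where "r = (\<lambda>i. \<lfloor>Re (coeff p0 i)\<rfloor>)"
  have r: "coeff p0 i = of_int (r i)" for i
    using p0(1)[of i] by (auto simp: r_def elim!: Ints_cases)
  have "m > 0"
  proof (rule ccontr)
    assume "\<not> m > 0"
    then obtain k where "p0 = [:k:]" unfolding m_def by (metis degree_eq_zeroE gr0I)
    thus False using p0 by auto
  qed
  have "r m \<noteq> 0" using p0(2) r[of m] unfolding m_def by (metis leading_coeff_0_iff of_int_0)
  have "poly p0 a = (\<Sum>i\<le>m. of_int (r i) * a ^ i)" by (simp add: poly_altdef r m_def)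
  also have "\<dots> = (\<Sum>i<m. of_int (r i) * a ^ i) + of_int (r m) * a ^ m"
    by (simp add: lessThan_Suc_atMost[symmetric])
  finally have rel0: "of_int (r m) * a ^ m = - (\<Sum>i<m. of_int (r i) * a ^ i)"
    using p0(3) by (simp add: eq_neg_iff_add_eq_0 add.commute)
  define q where "q = nat \<bar>r m\<bar>"
  define t where "t = (\<lambda>i. - sgn (r m) * r i)"
  have q: "int q = sgn (r m) * r m" "q \<ge> 1" using \<open>r m \<noteq> 0\<close> by (auto simp: q_def sgn_if)
  have rel: "of_nat q * a ^ m = (\<Sum>i<m. of_int (t i) * a ^ i)"
  proof -
    have "(of_nat q :: complex) = of_int (int q)" by simp
    also have "\<dots> = of_int (sgn (r m)) * of_int (r m)" by (simp only: q of_int_mult)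
    finally have "of_nat q * a ^ m = of_int (sgn (r m)) * (of_int (r m) * a ^ m)" by simp
    thus ?thesis unfolding rel0 by (simp add: t_def sum_distrib_left sum_negf algebra_simps)
  qed
  define C where "C = q + nat (\<Sum>i<m. \<bar>t i\<bar>)"
  have tC: "int q + \<bar>t i\<bar> \<le> int C" if "i < m" for i
  proof -
    have "\<bar>t i\<bar> \<le> (\<Sum>i<m. \<bar>t i\<bar>)" using that by (intro member_le_sum) auto
    thus ?thesis by (simp add: C_def)
  qed
  have base: "\<exists>c :: nat \<Rightarrow> int. of_nat q ^ e * a ^ e = (\<Sum>i<m. of_int (c i) * a ^ i) \<and>
        (\<forall>i<m. \<bar>c i\<bar> \<le> int C ^ e)" for e
  proof (induction e)
    case 0
    have "(\<Sum>i<m. of_int (if i = 0 then 1 else 0) * a ^ i) = (\<Sum>i<m. if i = 0 then 1 else 0)"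
      by (intro sum.cong) auto
    thus ?case using \<open>m > 0\<close> by (intro exI[of _ "\<lambda>i. if i = 0 then 1 else 0"]) auto
  next
    case (Suc e)
    then obtain c where c: "of_nat q ^ e * a ^ e = (\<Sum>i<m. of_int (c i) * a ^ i)"
      "\<And>i. i < m \<Longrightarrow> \<bar>c i\<bar> \<le> int C ^ e" by blast
    \<comment> \<open>Multiplication by \<open>q * a\<close> shifts the coordinates and turns the
      overflow \<open>q * a ^ m\<close> into \<open>t\<close>; each coordinate bound grows by at
      most \<open>q + \<bar>t i\<bar> \<le> C\<close>.\<close>
    define c' where "c' = (\<lambda>i. (if i = 0 then 0 else int q * c (i - 1)) + c (m - 1) * t i)"
    obtain m' where m': "m = Suc m'" using \<open>m > 0\<close> by (cases m) auto
    have "of_nat q ^ Suc e * a ^ Suc e = of_nat q * a * (\<Sum>i<m. of_int (c i) * a ^ i)"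
      using c(1) by (simp add: algebra_simps)
    also have "\<dots> = (\<Sum>i<m'. of_nat q * of_int (c i) * a ^ Suc i) + of_int (c m') * (of_nat q * a ^ m)"
      unfolding m' by (simp add: sum_distrib_left algebra_simps)
    also have "\<dots> = (\<Sum>i<m'. of_nat q * of_int (c i) * a ^ Suc i) + (\<Sum>i<m. of_int (c m') * of_int (t i) * a ^ i)"
      unfolding rel by (simp add: sum_distrib_left mult.assoc)
    also have "(\<Sum>i<m'. of_nat q * of_int (c i) * a ^ Suc i) =
        (\<Sum>i<m. of_int (if i = 0 then 0 else int q * c (i - 1)) * a ^ i)"
      unfolding m' by (subst sum.lessThan_Suc_shift) simp
    finally have "of_nat q ^ Suc e * a ^ Suc e = (\<Sum>i<m. of_int (c' i) * a ^ i)"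
      by (simp add: c'_def m' sum.distrib[symmetric] algebra_simps del: sum.lessThan_Suc)
    moreover have "\<bar>c' i\<bar> \<le> int C ^ Suc e" if "i < m" for i
    proof -
      have "\<bar>c' i\<bar> \<le> int q * int C ^ e + int C ^ e * \<bar>t i\<bar>"
        unfolding c'_def
      proof (intro order_trans[OF abs_triangle_ineq] add_mono)
        show "\<bar>if i = 0 then 0 else int q * c (i - 1)\<bar> \<le> int q * int C ^ e"
          using c(2)[of "i - 1"] that by (auto simp: abs_mult intro: mult_left_mono)
        show "\<bar>c (m - 1) * t i\<bar> \<le> int C ^ e * \<bar>t i\<bar>"
          using c(2)[of "m - 1"] \<open>m > 0\<close> by (simp add: abs_mult mult_right_mono)
      qed
      also have "\<dots> = (int q + \<bar>t i\<bar>) * int C ^ e" by (simp add: algebra_simps)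
      also have "\<dots> \<le> int C * int C ^ e" using tC[OF that] by (intro mult_right_mono) auto
      finally show ?thesis by simp
    qed
    ultimately show ?case by blast
  qed
  show ?thesis
  proof
    show "q \<ge> 1" "C \<ge> 1" using q by (auto simp: C_def)
    fix e d :: nat assume "e \<le> d"
    obtain c where c: "of_nat q ^ e * a ^ e = (\<Sum>i<m. of_int (c i) * a ^ i)"
      "\<And>i. i < m \<Longrightarrow> \<bar>c i\<bar> \<le> int C ^ e" using base by blast
    have "of_nat q ^ d * a ^ e = of_nat q ^ (d - e) * (of_nat q ^ e * a ^ e)"
      using \<open>e \<le> d\<close> by (simp add: power_add[symmetric] mult.assoc[symmetric])
    also have "\<dots> = (\<Sum>i<m. of_int (int q ^ (d - e) * c i) * a ^ i)"
      unfolding c by (simp add: sum_distrib_left algebra_simps)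
    finally have 1: "of_nat q ^ d * a ^ e = (\<Sum>i<m. of_int (int q ^ (d - e) * c i) * a ^ i)" .
    have "\<bar>int q ^ (d - e) * c i\<bar> \<le> int C ^ d" if "i < m" for i
    proof -
      have "\<bar>int q ^ (d - e) * c i\<bar> \<le> int C ^ (d - e) * int C ^ e"
        unfolding abs_mult using c(2)[OF that] by (intro mult_mono) (auto simp: C_def intro!: power_mono)
      thus ?thesis using \<open>e \<le> d\<close> by (simp add: power_add[symmetric])
    qed
    thus "\<exists>c :: nat \<Rightarrow> int. of_nat q ^ d * a ^ e = (\<Sum>i<m. of_int (c i) * a ^ i) \<and>
        (\<forall>i<m. \<bar>c i\<bar> \<le> int C ^ d)"
      by (intro exI[of _ "\<lambda>i. int q ^ (d - e) * c i"] conjI 1) simp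
  qed
qed

text \<open>The monomials in \<open>I\<close> serve all \<open>d\<close>, \<open>S\<close> and
  \<open>x\<close> at once. They take the place of a basis of a number field; spanning is all that
  the relation in the Liouville inequality asks for.\<close>

lemma rep_coordinates:
  assumes "algebraic a" "algebraic b"
  obtains q C :: nat and I :: "(nat \<times> nat) set" where "q \<ge> 1" "C \<ge> 1" "finite I"
    "\<And>d S x. rep a b d S x \<Longrightarrow> \<exists>c. of_nat q ^ d * x = (\<Sum>l\<in>I. of_int (c l) * (a ^ fst l * b ^ snd l)) \<and>
        (\<forall>l\<in>I. \<bar>c l\<bar> \<le> int (S * C ^ d))"
proof -
  obtain m q1 C1 where 1: "q1 \<ge> 1" "C1 \<ge> 1" 
    "\<And>e d. e \<le> d \<Longrightarrow> \<exists>c :: nat \<Rightarrow> int. of_nat q1 ^ d * a ^ e = (\<Sum>i<m. of_int (c i) * a ^ i) \<and>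
        (\<forall>i<m. \<bar>c i\<bar> \<le> int C1 ^ d)"
    by (rule algebraic_power_coordinates[OF assms(1)], rule that)
  obtain n q2 C2 where 2: "q2 \<ge> 1" "C2 \<ge> 1" 
    "\<And>e d. e \<le> d \<Longrightarrow> \<exists>c :: nat \<Rightarrow> int. of_nat q2 ^ d * b ^ e = (\<Sum>i<n. of_int (c i) * b ^ i) \<and>
        (\<forall>i<n. \<bar>c i\<bar> \<le> int C2 ^ d)"
    by (rule algebraic_power_coordinates[OF assms(2)], rule that)
  show ?thesis
  proof
    show "1 \<le> q1 * q2" "1 \<le> C1 * C2" using 1 2 by auto
    show "finite ({..<m} \<times> {..<n})" by simp
    fix d S x assume "rep a b d S x"
    thus "\<exists>c. of_nat (q1 * q2) ^ d * x = (\<Sum>l\<in>{..<m} \<times> {..<n}. of_int (c l) * (a ^ fst l * b ^ snd l)) \<and>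
        (\<forall>l\<in>{..<m} \<times> {..<n}. \<bar>c l\<bar> \<le> int (S * (C1 * C2) ^ d))"
    proof induction
      case (rep_zero d S)
      show ?case by (rule exI[of _ "\<lambda>_. 0"]) auto
    next
      case (rep_step d S x s i j)
      from rep_step.IH obtain c where c: "of_nat (q1 * q2) ^ d * x =
          (\<Sum>l\<in>{..<m} \<times> {..<n}. of_int (c l) * (a ^ fst l * b ^ snd l))"
        "\<And>l. l \<in> {..<m} \<times> {..<n} \<Longrightarrow> \<bar>c l\<bar> \<le> int (S * (C1 * C2) ^ d)" by blast
      obtain f where f: "of_nat q1 ^ d * a ^ i = (\<Sum>i<m. of_int (f i) * a ^ i)"
        "\<And>i. i < m \<Longrightarrow> \<bar>f i\<bar> \<le> int C1 ^ d"
        using 1(3)[of i d] rep_step by auto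
      obtain g where g: "of_nat q2 ^ d * b ^ j = (\<Sum>i<n. of_int (g i) * b ^ i)"
        "\<And>i. i < n \<Longrightarrow> \<bar>g i\<bar> \<le> int C2 ^ d"
        using 2(3)[of j d] rep_step by auto
      obtain s' :: int where s': "s = of_int s'" "\<bar>s'\<bar> = 1"
        using rep_step.hyps(2) by (cases "s = 1") (auto intro: that[of 1] that[of "-1"])
      have "of_nat (q1 * q2) ^ d * (x + s * a ^ i * b ^ j) = of_nat (q1 * q2) ^ d * x +
          s * ((of_nat q1 ^ d * a ^ i) * (of_nat q2 ^ d * b ^ j))"
        by (simp add: algebra_simps power_mult_distrib)
      also have "(of_nat q1 ^ d * a ^ i) * (of_nat q2 ^ d * b ^ j) =
          (\<Sum>l\<in>{..<m} \<times> {..<n}. of_int (f (fst l)) * a ^ fst l * (of_int (g (snd l)) * b ^ snd l))"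
        unfolding f g sum_product by (simp add: sum.cartesian_product case_prod_unfold)
      finally have "of_nat (q1 * q2) ^ d * (x + s * a ^ i * b ^ j) =
          (\<Sum>l\<in>{..<m} \<times> {..<n}. of_int (c l + s' * f (fst l) * g (snd l)) * (a ^ fst l * b ^ snd l))"
        unfolding c s' by (simp add: sum_distrib_left sum.distrib algebra_simps)
      moreover have "\<bar>c l + s' * f (fst l) * g (snd l)\<bar> \<le> int (Suc S * (C1 * C2) ^ d)"
        if "l \<in> {..<m} \<times> {..<n}" for l
      proof -
        have "\<bar>s' * f (fst l) * g (snd l)\<bar> \<le> int C1 ^ d * int C2 ^ d"
          unfolding abs_mult s' using that f(2)[of "fst l"] g(2)[of "snd l"]
          by (auto intro!: mult_mono)
        thus ?thesis using c(2)[OF that] by (simp add: power_mult_distrib algebra_simps)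
      qed
      ultimately show ?case by (intro exI[of _ "\<lambda>l. c l + s' * f (fst l) * g (snd l)"] conjI ballI)
    qed
  qed
qed

text \<open>No conjugates are needed: Siegel's lemma gives a short integer relation between the powers
  of \<open>x\<close>, and its lowest non-zero coefficient keeps \<open>x\<close> away from zero.\<close>
lemma liouville_inequality:
  assumes "algebraic a" "algebraic b"
  obtains K :: nat where "K \<ge> 1"
    "\<And>d S x. rep a b d S x \<Longrightarrow> S \<ge> 1 \<Longrightarrow> x \<noteq> 0 \<Longrightarrow> norm x \<le> 1 \<Longrightarrow>
       1 \<le> norm x * (real K * real S ^ K * real K ^ d)"
proof -
  obtain q C :: nat and I :: "(nat \<times> nat) set" where q: "q \<ge> 1" "C \<ge> 1" "finite I" and
    coord: "\<And>d S x. rep a b d S x \<Longrightarrow> \<exists>c. of_nat q ^ d * x = (\<Sum>l\<in>I. of_int (c l) * (a ^ fst l * b ^ snd l)) \<and>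
        (\<forall>l\<in>I. \<bar>c l\<bar> \<le> int (S * C ^ d))"
    by (rule rep_coordinates[OF assms], rule that)
  \<comment> \<open>The unknowns are the coefficients of \<open>1, x, ..., x ^ (n - 1)\<close>, the
    equations are the coordinates in \<open>I\<close>; Siegel's lemma wants twice as many
    unknowns.\<close>
  define n where "n = Suc (2 * card I)"
  \<comment> \<open>One number that dominates the constant \<open>2 * n * n\<close>, the exponent
    \<open>n\<close> of \<open>S\<close> and the base \<open>C ^ n\<close> of the degree.\<close>
  define K where "K = 2 * n * n * C ^ n + n"
  have n: "n \<ge> 1" by (simp add: n_def)
  have K: "K \<ge> 1" "n \<le> K" "C ^ n \<le> K" "2 * n * n \<le> K"
    using n q by (auto simp: K_def trans_le_add1)
  show ?thesis
  proof
    show "K \<ge> 1" by fact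
    fix d S x assume x: "rep a b d S x" "S \<ge> 1" "x \<noteq> 0" "norm x \<le> 1"
    define A where "A = S ^ n * C ^ (n * d)"
    have A: "A \<ge> 1" using x q by (simp add: A_def)
    have "\<forall>i. \<exists>c. i < n \<longrightarrow> of_nat q ^ (n * d) * x ^ i = (\<Sum>l\<in>I. of_int (c l) * (a ^ fst l * b ^ snd l)) \<and>
        (\<forall>l\<in>I. \<bar>c l\<bar> \<le> int A)"
    proof (intro allI)
      fix i
      have "rep a b (n * d) (S ^ n) (x ^ i)" if "i < n"
        by (rule rep_mono[OF rep_power[OF x(1)]]) (use that x in \<open>auto intro: power_increasing\<close>)
      from coord[OF this] show "\<exists>c. i < n \<longrightarrow> of_nat q ^ (n * d) * x ^ i = (\<Sum>l\<in>I. of_int (c l) * (a ^ fst l * b ^ snd l)) \<and>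
        (\<forall>l\<in>I. \<bar>c l\<bar> \<le> int A)" by (cases "i < n") (auto simp: A_def)
    qed
    from choice[OF this] obtain c where c: "\<And>i. i < n \<Longrightarrow> of_nat q ^ (n * d) * x ^ i = (\<Sum>l\<in>I. of_int (c i l) * (a ^ fst l * b ^ snd l))"
      "\<And>i l. i < n \<Longrightarrow> l \<in> I \<Longrightarrow> \<bar>c i l\<bar> \<le> int A" by blast
    obtain y where y: "\<exists>i\<in>{..<n}. y i \<noteq> 0" "\<And>i. i \<in> {..<n} \<Longrightarrow> \<bar>y i\<bar> \<le> int (2 * card {..<n} * A)"
      "\<And>l. l \<in> I \<Longrightarrow> (\<Sum>i<n. c i l * y i) = 0"
      by (rule siegel_lemma[of "{..<n}" I "\<lambda>l i. c i l" A]) (use c q A in \<open>auto simp: n_def\<close>)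
    have "of_nat q ^ (n * d) * (\<Sum>i<n. of_int (y i) * x ^ i) =
        (\<Sum>i<n. \<Sum>l\<in>I. of_int (c i l * y i) * (a ^ fst l * b ^ snd l))"
      unfolding sum_distrib_left
    proof (intro sum.cong refl)
      fix i assume "i \<in> {..<n}"
      hence "of_nat q ^ (n * d) * (of_int (y i) * x ^ i) =
         of_int (y i) * (\<Sum>l\<in>I. of_int (c i l) * (a ^ fst l * b ^ snd l))"
        using c(1)[of i] by (simp add: algebra_simps)
      thus "of_nat q ^ (n * d) * (of_int (y i) * x ^ i) =
         (\<Sum>l\<in>I. of_int (c i l * y i) * (a ^ fst l * b ^ snd l))"
        by (simp add: sum_distrib_left algebra_simps)
    qed
    also have "\<dots> = (\<Sum>l\<in>I. of_int (\<Sum>i<n. c i l * y i) * (a ^ fst l * b ^ snd l))"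
      unfolding of_int_sum sum_distrib_right by (rule sum.swap)
    also have "\<dots> = 0" using y(3) by (intro sum.neutral) auto
    finally have rel: "(\<Sum>i<n. of_int (y i) * x ^ i) = 0" using q by simp
    define r where "r = (LEAST i. y i \<noteq> 0)"
    obtain i0 where i0: "i0 < n" "y i0 \<noteq> 0" using y(1) by auto
    have r: "y r \<noteq> 0" "r \<le> i0" "\<And>i. i < r \<Longrightarrow> y i = 0"
      using LeastI[of "\<lambda>i. y i \<noteq> 0", OF i0(2)] Least_le[of "\<lambda>i. y i \<noteq> 0", OF i0(2)] not_less_Least[of _ "\<lambda>i. y i \<noteq> 0"]
      unfolding r_def by blast+
    have "{..<n} = {..<r} \<union> insert r {Suc r..<n}" using r i0 by auto
    hence "(\<Sum>i<n. of_int (y i) * x ^ i) = (\<Sum>i\<in>{..<r} \<union> insert r {Suc r..<n}. of_int (y i) * x ^ i)"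
      by simp
    also have "\<dots> = (\<Sum>i<r. of_int (y i) * x ^ i) + (of_int (y r) * x ^ r + (\<Sum>i=Suc r..<n. of_int (y i) * x ^ i))"
      by (subst sum.union_disjoint) auto
    also have "(\<Sum>i<r. of_int (y i) * x ^ i) = 0" using r by (intro sum.neutral) auto
    finally have "of_int (y r) * x ^ r = - (\<Sum>i=Suc r..<n. of_int (y i) * x ^ i)"
      using rel by (simp add: eq_neg_iff_add_eq_0)
    hence "norm (of_int (y r) * x ^ r) \<le> (\<Sum>i=Suc r..<n. norm (of_int (y i) * x ^ i))"
      by (simp add: norm_sum)
    \<comment> \<open>Because \<open>norm x \<le> 1\<close>, every later term has at least one more
      factor \<open>norm x\<close> than the lowest one; cancelling \<open>norm x ^ r\<close> leaves
      the lower bound.\<close>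
    also have "\<dots> \<le> (\<Sum>i=Suc r..<n. real (2 * n * A) * norm x ^ Suc r)"
    proof (intro sum_mono)
      fix i assume i: "i \<in> {Suc r..<n}"
      have "real_of_int \<bar>y i\<bar> \<le> real (2 * n * A)"
        using y(2)[of i] i by (metis (no_types, lifting) atLeastLessThan_iff card_lessThan lessThan_iff of_int_le_iff of_int_of_nat_eq)
      moreover have "norm x ^ i \<le> norm x ^ Suc r" using i x by (intro power_decreasing) auto
      ultimately show "norm (of_int (y i) * x ^ i) \<le> real (2 * n * A) * norm x ^ Suc r"
        unfolding norm_mult norm_power norm_of_int by (intro mult_mono) auto
    qed
    also have "\<dots> \<le> real n * (real (2 * n * A) * norm x ^ Suc r)"
      unfolding sum_constant by (intro mult_right_mono) auto
    finally have "real_of_int \<bar>y r\<bar> * norm x ^ r \<le> (real n * real (2 * n * A) * norm x) * norm x ^ r"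
      by (simp add: norm_mult norm_power algebra_simps)
    hence "real_of_int \<bar>y r\<bar> \<le> real n * real (2 * n * A) * norm x"
      using x by (simp del: of_nat_mult)
    moreover have "1 \<le> \<bar>y r\<bar>" using r by linarith
    ultimately have "1 \<le> norm x * real (2 * n * n * A)" by (simp add: algebra_simps)
    also have "2 * n * n * A \<le> K * S ^ K * K ^ d"
    proof -
      have "S ^ n \<le> S ^ K" "(C ^ n) ^ d \<le> K ^ d" using K x by (auto intro: power_increasing power_mono)
      hence "2 * n * n * (S ^ n * (C ^ n) ^ d) \<le> K * (S ^ K * K ^ d)" using K(4) by (intro mult_le_mono)
      thus ?thesis by (simp add: A_def power_mult mult.assoc)
    qed
    hence "norm x * real (2 * n * n * A) \<le> norm x * real (K * S ^ K * K ^ d)"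
      by (intro mult_left_mono) (auto simp del: of_nat_mult)
    finally show "1 \<le> norm x * (real K * real S ^ K * real K ^ d)" by simp
  qed
qed

section \<open>Integer polynomials in two variables along a power series\<close>

definition ev :: "'a :: idom fps \<Rightarrow> 'a poly poly \<Rightarrow> 'a fps" where
  "ev F P = poly (map_poly fps_of_poly P) F"

lemma ev_0 [simp]: "ev F 0 = 0"
  by (simp add: ev_def)

lemma ev_pCons: "ev F (pCons a P) = fps_of_poly a + F * ev F P"
  by (simp add: ev_def map_poly_pCons)

lemma ev_const: "ev F [:a:] = fps_of_poly a"
  by (simp add: ev_pCons)

lemma ev_add: "ev F (P + Q) = ev F P + ev F Q"
proof (induction P arbitrary: Q)
  case (pCons a P)
  show ?case
    by (cases Q) (simp add: ev_pCons pCons.IH fps_of_poly_add, simp add: algebra_simps)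
qed simp

lemma ev_smult: "ev F (smult a P) = fps_of_poly a * ev F P"
  by (induction P) (simp_all add: ev_pCons fps_of_poly_mult algebra_simps)

lemma ev_mult: "ev F (P * Q) = ev F P * ev F Q"
  by (induction P) (simp_all add: ev_pCons ev_add ev_smult algebra_simps)

lemma ev_1 [simp]: "ev F 1 = 1"
  by (simp add: one_pCons ev_pCons)

lemma ev_diff: "ev F (P - Q) = ev F P - ev F Q"
  using ev_add[of F "P - Q" Q] by simp

lemma ev_sum: "ev F (sum f A) = (\<Sum>x\<in>A. ev F (f x))"
  by (induction A rule: infinite_finite_induct) (simp_all add: ev_add)

lemma ev_monom: "ev F (monom a n) = fps_of_poly a * F ^ n"
  by (induction n) (simp_all add: monom_0 monom_Suc ev_pCons)

section \<open>The degree in the inner variable\<close>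

definition degz :: "'a :: zero poly poly \<Rightarrow> nat" where
  "degz P = Max ((\<lambda>i. degree (coeff P i)) ` {..degree P})"

lemma degree_coeff_le_degz: "degree (coeff P i) \<le> degz P"
proof (cases "i \<le> degree P")
  case True
  thus ?thesis unfolding degz_def by (intro Max_ge) auto
qed (simp add: coeff_eq_0)

lemma degz_le: "(\<And>i. degree (coeff P i) \<le> d) \<Longrightarrow> degz P \<le> d"
  unfolding degz_def by (subst Max_le_iff) auto

text \<open>Taking the last index at which the inner degree is attained leaves a single non-zero
  term in the convolution of two top parts, so nothing can cancel.\<close>

lemma degz_witness:
  assumes "P \<noteq> 0"
  obtains i where "coeff P i \<noteq> 0" "degree (coeff P i) = degz P"
    "\<And>j. j > i \<Longrightarrow> coeff (coeff P j) (degz P) = 0"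
proof -
  define A where "A = {i. coeff (coeff P i) (degz P) \<noteq> 0}"
  have sub: "A \<subseteq> {..degree P}" unfolding A_def
    by (auto intro!: le_degree)
  have fin: "finite A" by (rule finite_subset[OF sub]) auto
  have "A \<noteq> {}"
  proof -
    have "degz P \<in> (\<lambda>i. degree (coeff P i)) ` {..degree P}"
      unfolding degz_def by (intro Max_in) auto
    then obtain i where i: "degz P = degree (coeff P i)" by auto
    show ?thesis
    proof (cases "coeff P i = 0")
      \<comment> \<open>The zero polynomial has degree 0, so the maximum may sit at a vanishing
        coefficient. Then \<open>degz P = 0\<close>, and the leading coefficient is a
        witness.\<close>
      case True
      hence "degz P = 0" using i by simp
      hence "degree (coeff P (degree P)) = degz P"
        using degree_coeff_le_degz[of P "degree P"] by simp
      hence "coeff (coeff P (degree P)) (degz P) \<noteq> 0"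
        using assms by (metis leading_coeff_0_iff)
      thus ?thesis unfolding A_def by blast
    next
      case False
      hence "coeff (coeff P i) (degree (coeff P i)) \<noteq> 0" by simp
      thus ?thesis unfolding A_def i by blast
    qed
  qed
  hence mA: "Max A \<in> A" using fin by (rule Max_in[rotated])
  show ?thesis
  proof
    show "coeff P (Max A) \<noteq> 0" using mA by (auto simp: A_def)
    show "degree (coeff P (Max A)) = degz P"
      using mA degree_coeff_le_degz[of P "Max A"] le_degree[of "coeff P (Max A)" "degz P"]
      by (auto simp: A_def)
    show "coeff (coeff P j) (degz P) = 0" if "j > Max A" for j
    proof -
      have "j \<notin> A" using Max_ge[OF fin, of j] that by auto
      thus ?thesis by (simp add: A_def)
    qed
  qed
qed

lemma coeff_mult_top:
  assumes "degree p \<le> m" "degree q \<le> n"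
  shows "coeff (p * q) (m + n) = coeff p m * coeff q n"
proof -
  have "coeff (p * q) (m + n) = (\<Sum>i\<le>m + n. coeff p i * coeff q (m + n - i))" by (rule coeff_mult)
  also have "\<dots> = (\<Sum>i\<in>{m}. coeff p i * coeff q (m + n - i))"
  proof (rule sum.mono_neutral_right)
    show "\<forall>i\<in>{..m + n} - {m}. coeff p i * coeff q (m + n - i) = 0"
    proof
      fix i assume i: "i \<in> {..m + n} - {m}"
      show "coeff p i * coeff q (m + n - i) = 0"
      proof (cases "i > m")
        case True
        thus ?thesis using assms by (simp add: coeff_eq_0)
      next
        case False
        hence "m + n - i > n" using i by auto
        thus ?thesis using assms by (simp add: coeff_eq_0)
      qed
    qed
  qed auto
  finally show ?thesis by simp
qed

text \<open>A leading-term argument in the inner variable. It hands the bound on \<open>degz\<close>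
  down from a polynomial to its factors.\<close>

lemma degz_mult_ge:
  fixes P Q :: "'a :: idom poly poly"
  assumes "P \<noteq> 0" "Q \<noteq> 0"
  shows "degz P + degz Q \<le> degz (P * Q)"
proof -
  obtain i where i: "coeff P i \<noteq> 0" "degree (coeff P i) = degz P"
    "\<And>j. j > i \<Longrightarrow> coeff (coeff P j) (degz P) = 0" using degz_witness[OF assms(1)] by blast
  obtain j where j: "coeff Q j \<noteq> 0" "degree (coeff Q j) = degz Q"
    "\<And>i. i > j \<Longrightarrow> coeff (coeff Q i) (degz Q) = 0" using degz_witness[OF assms(2)] by blast
  have "coeff (coeff (P * Q) (i + j)) (degz P + degz Q) =
      (\<Sum>k\<le>i + j. coeff (coeff P k) (degz P) * coeff (coeff Q (i + j - k)) (degz Q))"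
    by (simp add: coeff_mult[of P] coeff_sum coeff_mult_top degree_coeff_le_degz)
  also have "\<dots> = (\<Sum>k\<in>{i}. coeff (coeff P k) (degz P) * coeff (coeff Q (i + j - k)) (degz Q))"
  proof (rule sum.mono_neutral_right)
    show "\<forall>k\<in>{..i + j} - {i}. coeff (coeff P k) (degz P) * coeff (coeff Q (i + j - k)) (degz Q) = 0"
    proof
      fix k assume k: "k \<in> {..i + j} - {i}"
      show "coeff (coeff P k) (degz P) * coeff (coeff Q (i + j - k)) (degz Q) = 0"
      proof (cases "k > i")
        case False
        hence "i + j - k > j" using k by auto
        thus ?thesis using j(3) by simp
      qed (simp add: i(3))
    qed
  qed auto
  also have "\<dots> \<noteq> 0" using i(1,2) j(1,2) by (simp flip: i(2) j(2))
  finally have "degz P + degz Q \<le> degree (coeff (P * Q) (i + j))" by (rule le_degree)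
  also have "\<dots> \<le> degz (P * Q)" by (rule degree_coeff_le_degz)
  finally show ?thesis .
qed

lemma degz_dvd_le:
  fixes P Q :: "'a :: idom poly poly"
  assumes "G dvd P" "P \<noteq> 0"
  shows "degz G \<le> degz P"
  using assms degz_mult_ge by (metis add_leD1 dvd_def mult_eq_0_iff)

section \<open>Prime factors of integer polynomials in two variables\<close>

lemma prime_factor_pos_degree:
  fixes Q :: "int poly poly"
  assumes "degree Q > 0"
  obtains G where "prime_elem G" "degree G > 0" "G dvd Q"
proof -
  have "degree Q > 0 \<Longrightarrow> \<exists>G. prime_elem G \<and> degree G > 0 \<and> G dvd Q"
  proof (induction Q rule: prime_divisors_induct)
    case (unit x)
    thus ?case by (auto simp: is_unit_poly_iff)
  next
    case (factor p x)
    show ?case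
    proof (cases "degree p > 0")
      case True
      thus ?thesis using factor by (intro exI[of _ p]) (auto simp: prime_def)
    next
      case False
      hence "degree x > 0" using factor.prems degree_mult_le[of p x] by linarith
      then obtain G where "prime_elem G" "degree G > 0" "G dvd x" using factor.IH by blast
      thus ?thesis by (intro exI[of _ G]) auto
    qed
  qed auto
  thus ?thesis using assms that by blast
qed

text \<open>Undoes the multiplication by a leading coefficient in pseudo-division: a prime of
  positive outer degree cannot divide a polynomial in \<open>x\<close> alone.\<close>

lemma prime_elem_dvd_const_mult:
  fixes G :: "int poly poly"
  assumes "prime_elem G" "degree G > 0" "G dvd [:c:] * P" "c \<noteq> 0"
  shows "G dvd P"
proof -
  have "\<not> G dvd [:c:]"
  proof
    assume "G dvd [:c:]"
    hence "degree G \<le> degree [:c:]" using assms(4) by (intro dvd_imp_degree_le) auto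
    thus False using assms(2) by simp
  qed
  thus ?thesis using assms(1,3) prime_elem_dvd_multD by blast
qed

section \<open>Order of vanishing along a transcendental power series\<close>

locale transcendental_fps =
  fixes F :: "int fps"
  assumes ev_nonzero: "P \<noteq> 0 \<Longrightarrow> ev F P \<noteq> 0"
begin

text \<open>By convention \<open>vord 0 = 0\<close>, which is why zero polynomials appear as a
  separate alternative below; on non-zero polynomials \<open>ev_nonzero\<close> makes this a
  valuation.\<close>

definition vord :: "int poly poly \<Rightarrow> nat" where "vord P = subdegree (ev F P)"

lemma vord_mult: "P \<noteq> 0 \<Longrightarrow> Q \<noteq> 0 \<Longrightarrow> vord (P * Q) = vord P + vord Q"
  by (simp add: vord_def ev_mult ev_nonzero)

lemma vord_unit: "is_unit u \<Longrightarrow> vord u = 0"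
proof -
  assume "is_unit u"
  then obtain v where v: "1 = u * v" by (auto simp: dvd_def)
  hence "u \<noteq> 0" "v \<noteq> 0" by auto
  hence "vord u + vord v = vord 1" using v vord_mult[of u v] by simp
  thus "vord u = 0" by (simp add: vord_def)
qed

text \<open>Once \<open>y\<close> has been eliminated, order is limited by degree; every
  contradiction between large order and small degree ends here.\<close>

lemma vord_const: "vord [:c:] \<le> degree c"
proof (cases "c = 0")
  case False
  hence "fps_of_poly c $ degree c \<noteq> 0" by simp
  thus ?thesis unfolding vord_def ev_const using subdegree_leI by blast
qed (simp add: vord_def)

lemma vord_diff_ge:
  assumes "P - Q \<noteq> 0" "n < vord P \<or> P = 0" "n < vord Q \<or> Q = 0"
  shows "n < vord (P - Q)"
proof -
  have "ev F (P - Q) $ i = 0" if "i < Suc n" for i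
    using assms(2,3) that unfolding vord_def ev_diff by (auto simp: nth_less_subdegree_zero)
  hence "Suc n \<le> vord (P - Q)" unfolding vord_def using ev_nonzero[OF assms(1)]
    by (intro subdegree_geI) auto
  thus ?thesis by simp
qed

text \<open>One pseudo-division step lowers the total degree in the outer variable and at most
  doubles the inner degree, while the order of vanishing does not drop.\<close>
lemma common_prime_factor:
  assumes "P \<noteq> 0" "Q \<noteq> 0" "degree P + degree Q \<le> n" "degz P \<le> d" "degz Q \<le> d"
    "2 ^ n * d < vord P" "2 ^ n * d < vord Q"
  shows "\<exists>G. prime_elem G \<and> degree G > 0 \<and> G dvd P \<and> G dvd Q"
  using assms
proof (induction n arbitrary: P Q d)
  case (0 P Q d)
  obtain c where "P = [:c:]" using 0 by (metis add_is_0 degree_eq_zeroE le_zero_eq)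
  thus ?case using 0 vord_const[of c] degree_coeff_le_degz[of P 0] by simp
next
  case (Suc n)
  \<comment> \<open>\<open>?case\<close> speaks of the original pair, while \<open>P\<close> and
    \<open>Q\<close> here may be that pair swapped; the last premise carries a common factor
    back.\<close>
  have step: ?case if PQ: "P \<noteq> 0" "Q \<noteq> 0" "degree P + degree Q \<le> Suc n" "degz P \<le> d" "degz Q \<le> d"
    "2 ^ Suc n * d < vord P" "2 ^ Suc n * d < vord Q" "degree Q \<le> degree P" 
    "\<And>G. prime_elem G \<and> degree G > 0 \<and> G dvd P \<and> G dvd Q \<Longrightarrow> ?case" for P Q
  proof -
    have pos: "degree Q > 0"
    proof (rule ccontr)
      assume "\<not> ?thesis"
      then obtain c where c: "Q = [:c:]" by (metis degree_eq_zeroE gr0I)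
      have "vord Q \<le> degz Q" using vord_const[of c] degree_coeff_le_degz[of Q 0] c by simp
      also have "\<dots> \<le> 2 ^ Suc n * d" using PQ(5) by (metis le_trans mult_le_mono1 mult_1 one_le_numeral one_le_power)
      finally show False using PQ(7) by simp
    qed
    define a b where "a = lead_coeff Q" and "b = lead_coeff P"
    define M where "M = monom b (degree P - degree Q)"
    define R where "R = [:a:] * P - M * Q"
    have ab: "a \<noteq> 0" "b \<noteq> 0" using PQ by (auto simp: a_def b_def)
    have M: "M \<noteq> 0" using ab by (simp add: M_def)
    have dvdP: "G dvd P" if "prime_elem G" "degree G > 0" "G dvd R" "G dvd Q" for G
    proof -
      have "G dvd R + M * Q" using that by simp
      hence "G dvd [:a:] * P" by (simp add: R_def)
      thus ?thesis using prime_elem_dvd_const_mult that ab by blast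
    qed
    show ?thesis
    proof (cases "R = 0")
      case True
      obtain G where "prime_elem G" "degree G > 0" "G dvd Q" using prime_factor_pos_degree[OF pos] by blast
      thus ?thesis using dvdP[of G] True PQ(9)[of G] by auto
    next
      case False
      have "degree R < degree P"
      proof -
        have 1: "degree ([:a:] * P) \<le> degree P" by (simp add: degree_smult_le)
        have "degree (M * Q) \<le> degree M + degree Q" by (rule degree_mult_le)
        also have "\<dots> \<le> degree P" using PQ(8) degree_monom_le[of b "degree P - degree Q"] by (simp add: M_def)
        finally have "degree R \<le> degree P" unfolding R_def using 1 by (intro degree_diff_le)
        moreover have "coeff R (degree P) = 0"
          using PQ(8) by (simp add: R_def M_def coeff_monom_mult a_def b_def)
        ultimately show ?thesis using pos PQ(8) False
          by (metis eq_zero_or_degree_less gr0_implies_Suc less_numeral_extra(3) not_gr_zero le_less leading_coeff_0_iff)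
      qed
      hence "degree R + degree Q \<le> n" using PQ(3) by simp
      moreover have "degz R \<le> 2 * d"
      proof (rule degz_le)
        fix i
        have *: "degree (a * x) \<le> 2 * d" if "degree a \<le> d" "degree x \<le> d" for a x :: "int poly"
          using degree_mult_le[of a x] that by linarith
        have da: "degree a \<le> d" "degree b \<le> d" using PQ(4,5) degree_coeff_le_degz le_trans unfolding a_def b_def by blast+
        have "degree (coeff P i) \<le> d" "degree (coeff Q (i - (degree P - degree Q))) \<le> d"
          using PQ(4,5) degree_coeff_le_degz le_trans by blast+
        thus "degree (coeff R i) \<le> 2 * d"
          unfolding R_def M_def using da by (auto simp: coeff_monom_mult intro!: degree_diff_le *)
      qed
      \<comment> \<open>The threshold is designed for this: it does not change when \<open>n\<close>
        drops by one and \<open>d\<close> doubles.\<close>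
      moreover have "2 ^ n * (2 * d) < vord R"
      proof -
        have "2 ^ n * (2 * d) < vord ([:a:] * P)" "2 ^ n * (2 * d) < vord (M * Q)"
          using PQ(1,2,6,7) ab M by (subst vord_mult; simp)+
        thus ?thesis unfolding R_def by (intro vord_diff_ge) (use False R_def in auto)
      qed
      ultimately obtain G where "prime_elem G" "degree G > 0" "G dvd R" "G dvd Q"
        using Suc.IH[of R Q "2 * d"] False PQ by auto
      thus ?thesis using dvdP[of G] PQ(9)[of G] by auto
    qed
  qed
  show ?case
  proof (cases "degree Q \<le> degree P")
    case True
    thus ?thesis using step[of P Q] Suc.prems by blast
  next
    case False
    thus ?thesis using step[of Q P] Suc.prems by (auto simp: add.commute)
  qed
qed

text \<open>Order and \<open>degree\<close> add up over a factorization and \<open>degz\<close> is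
  superadditive, so if every prime factor satisfied the opposite inequality, \<open>P\<close> would
  too; units have order 0.\<close>

lemma prime_factor_large_order:
  assumes "P \<noteq> 0" "K * (degz P + degree P) < vord P"
  obtains G where "prime_elem G" "G dvd P" "K * (degz G + degree G) < vord G"
proof -
  have "P \<noteq> 0 \<Longrightarrow> K * (degz P + degree P) < vord P \<Longrightarrow>
      \<exists>G. prime_elem G \<and> G dvd P \<and> K * (degz G + degree G) < vord G"
  proof (induction P rule: prime_divisors_induct)
    case (unit x)
    thus ?case by (simp add: vord_unit)
  next
    case (factor p x)
    have nz: "p \<noteq> 0" "x \<noteq> 0" using factor.prems by auto
    show ?case
    proof (cases "K * (degz p + degree p) < vord p")
      case True
      thus ?thesis using factor.hyps by (intro exI[of _ p]) (auto simp: prime_def)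
    next
      case False
      have "K * (degz p + degree p) + K * (degz x + degree x) \<le> K * (degz (p * x) + degree (p * x))"
        unfolding distrib_left[symmetric] using degz_mult_ge[OF nz] degree_mult_eq[OF nz]
        by (intro mult_le_mono2) simp
      hence "K * (degz x + degree x) < vord x" using factor.prems False vord_mult[OF nz] by linarith
      then obtain G where "prime_elem G" "G dvd x" "K * (degz G + degree G) < vord G"
        using factor.IH nz by blast
      thus ?thesis by (intro exI[of _ G]) auto
    qed
  qed auto
  thus ?thesis using assms that by blast
qed

lemma vord_eq_if_prime_dvd:
  assumes "prime_elem G" "prime_elem H" "G dvd H"
  shows "vord H = vord G"
proof -
  obtain u where u: "H = G * u" using assms(3) by (auto simp: dvd_def)
  have "is_unit u" using assms u
    by (metis irreducible_def prime_elem_imp_irreducible)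
  thus ?thesis using u assms vord_mult[of G u] vord_unit[of u] by (cases "u = 0") auto
qed

text \<open>The prime factors of \<open>P k\<close> and \<open>P (Suc k)\<close> carrying the large order are associated, so their
  order stays constant although it has to grow.\<close>
lemma order_not_too_large:
  assumes P: "\<And>k. k \<ge> k0 \<Longrightarrow> P k \<noteq> 0 \<and> degree (P k) \<le> L \<and> degz (P k) \<le> c * k"
    and ord: "\<And>k. k \<ge> k0 \<Longrightarrow> (2 ^ (2 * L) * (2 * c) * k) * (c * k + L) < vord (P k)"
    and c: "c \<ge> 1" "k0 \<ge> 1"
  shows False
proof -
  \<comment> \<open>\<open>2 ^ (2 * L)\<close> is the price of \<open>common_prime_factor\<close>
    for two polynomials of degree at most \<open>L\<close>, and \<open>2 * c\<close> covers the
    inner degree \<open>c * Suc k \<le> 2 * c * k\<close>.\<close>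
  define Z where "Z = 2 ^ (2 * L) * (2 * c)"
  have Z: "Z \<ge> 1" using c by (simp add: Z_def)
  have "\<exists>G. prime_elem G \<and> degree G \<le> L \<and> degz G \<le> c * k \<and> Z * k < vord G" if k: "k \<ge> k0" for k
  proof -
    have "(Z * k) * (degz (P k) + degree (P k)) \<le> (Z * k) * (c * k + L)"
      using P[OF k] by (intro mult_le_mono2) auto
    also have "\<dots> < vord (P k)" using ord[OF k] by (simp add: Z_def)
    finally obtain G where G: "prime_elem G" "G dvd P k" "Z * k * (degz G + degree G) < vord G"
      using prime_factor_large_order P[OF k] by metis
    have "degree G \<le> L" using G P[OF k] dvd_imp_degree_le le_trans by blast
    moreover have "degz G \<le> c * k" using G P[OF k] degz_dvd_le le_trans by blast
    \<comment> \<open>With both degrees 0 the order would be 0 as well. Hence the bound relative to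
      the degrees becomes the absolute bound \<open>Z * k < vord G\<close>.\<close>
    moreover have "degz G + degree G \<noteq> 0"
    proof
      assume "degz G + degree G = 0"
      then obtain x where x: "G = [:x:]" by (metis add_is_0 degree_eq_zeroE)
      thus False using vord_const[of x] G(3) degree_coeff_le_degz[of G 0] \<open>degz G + degree G = 0\<close> by simp
    qed
    hence "Z * k * 1 \<le> Z * k * (degz G + degree G)" by (intro mult_le_mono2) auto
    hence "Z * k < vord G" using G(3) by linarith
    ultimately show ?thesis using G(1) by blast
  qed
  then obtain G where G: "\<And>k. k \<ge> k0 \<Longrightarrow> prime_elem (G k) \<and> degree (G k) \<le> L \<and> degz (G k) \<le> c * k \<and> Z * k < vord (G k)"
    by metis
  have step: "vord (G (Suc k)) = vord (G k)" if k: "k \<ge> k0" for k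
  proof -
    have G1: "prime_elem (G k)" "degree (G k) \<le> L" "degz (G k) \<le> c * k" "Z * k < vord (G k)"
      using G[OF k] by auto
    have G2: "prime_elem (G (Suc k))" "degree (G (Suc k)) \<le> L" "degz (G (Suc k)) \<le> c * Suc k" "Z * Suc k < vord (G (Suc k))"
      using G[of "Suc k"] k by auto
    have "c * Suc k \<le> 2 * c * k" using k c by simp
    hence "2 ^ (2 * L) * (c * Suc k) \<le> 2 ^ (2 * L) * (2 * c * k)" by (intro mult_le_mono2)
    hence *: "2 ^ (2 * L) * (c * Suc k) \<le> Z * k" by (simp add: Z_def algebra_simps)
    have "\<exists>H. prime_elem H \<and> degree H > 0 \<and> H dvd G k \<and> H dvd G (Suc k)"
    proof (rule common_prime_factor[of _ _ "2 * L" "c * Suc k"])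
      show "G k \<noteq> 0" "G (Suc k) \<noteq> 0" using G1(1) G2(1) by auto
      show "degree (G k) + degree (G (Suc k)) \<le> 2 * L" using G1 G2 by simp
      show "degz (G k) \<le> c * Suc k" "degz (G (Suc k)) \<le> c * Suc k" using G1 G2 by auto
      show "2 ^ (2 * L) * (c * Suc k) < vord (G k)" using * G1 by linarith
      have "Z * k \<le> Z * Suc k" by simp
      thus "2 ^ (2 * L) * (c * Suc k) < vord (G (Suc k))" using * G2 by linarith
    qed
    thus ?thesis using vord_eq_if_prime_dvd G1(1) G2(1) by metis
  qed
  have const: "vord (G (k0 + n)) = vord (G k0)" for n
    by (induction n) (use step in auto)
  \<comment> \<open>An index so large that the growing lower bound exceeds the constant
    order.\<close>
  have "Z * (k0 + vord (G k0)) < vord (G k0)" using G[of "k0 + vord (G k0)"] const[of "vord (G k0)"] by simp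
  moreover have "vord (G k0) \<le> Z * (k0 + vord (G k0))"
    using Z by (metis le_add2 le_trans mult_le_mono1 mult_1)
  ultimately show False by simp
qed

end

section \<open>Auxiliary polynomials and power series estimates\<close>

text \<open>The base gets worse with every multiplication by \<open>F\<close>; a common
  \<open>D\<close> exists because only \<open>J\<close> powers are involved.\<close>

lemma fps_power_coeff_bound:
  fixes F :: "int fps" and C :: nat
  assumes "\<And>n. \<bar>F $ n\<bar> \<le> int C ^ Suc n"
  obtains D :: nat where "D \<ge> 1" "\<And>j n. j < J \<Longrightarrow> \<bar>(F ^ j) $ n\<bar> \<le> int D ^ Suc n"
proof -
  have *: "\<exists>D\<ge>1. \<forall>n. \<bar>(F ^ j) $ n\<bar> \<le> int D ^ Suc n" for j
  proof (induction j)
    case 0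
    show ?case by (intro exI[of _ 1]) auto
  next
    case (Suc j)
    then obtain D where D: "D \<ge> 1" "\<And>n. \<bar>(F ^ j) $ n\<bar> \<le> int D ^ Suc n" by blast
    define E where "E = D + C"
    have E: "\<bar>(F ^ j) $ n\<bar> \<le> int E ^ Suc n" "\<bar>F $ n\<bar> \<le> int E ^ Suc n" for n
      using D(2)[of n] assms[of n] power_mono[of "int D" "int E" "Suc n"] power_mono[of "int C" "int E" "Suc n"]
      by (auto simp: E_def)
    \<comment> \<open>The convolution has \<open>n + 1 \<le> 2 ^ (n + 1)\<close> terms, each at most
      \<open>E ^ (n + 2) \<le> E ^ (2 * (n + 1))\<close>.\<close>
    have "\<bar>(F ^ Suc j) $ n\<bar> \<le> int (2 * E\<^sup>2) ^ Suc n" for n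
    proof -
      have "\<bar>(F ^ Suc j) $ n\<bar> = \<bar>\<Sum>i=0..n. F $ i * (F ^ j) $ (n - i)\<bar>" by (simp add: fps_mult_nth)
      also have "\<dots> \<le> (\<Sum>i=0..n. \<bar>F $ i * (F ^ j) $ (n - i)\<bar>)" by (rule sum_abs)
      also have "\<dots> \<le> (\<Sum>i=0..n. ((int E)\<^sup>2) ^ Suc n)"
      proof (intro sum_mono)
        fix i assume i: "i \<in> {0..n}"
        have "\<bar>F $ i * (F ^ j) $ (n - i)\<bar> \<le> int E ^ Suc i * int E ^ Suc (n - i)"
          unfolding abs_mult using E by (intro mult_mono) auto
        also have "\<dots> = int E ^ (n + 2)" using i by (simp flip: power_add)
        also have "\<dots> \<le> int E ^ (2 * Suc n)" using D by (intro power_increasing) (auto simp: E_def)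
        finally show "\<bar>F $ i * (F ^ j) $ (n - i)\<bar> \<le> ((int E)\<^sup>2) ^ Suc n" unfolding power_mult .
      qed
      also have "\<dots> = int (Suc n) * ((int E)\<^sup>2) ^ Suc n" by simp
      also have "\<dots> \<le> 2 ^ Suc n * ((int E)\<^sup>2) ^ Suc n"
      proof (intro mult_right_mono)
        have "Suc n < 2 ^ Suc n" by (rule less_exp)
        hence "int (Suc n) < int (2 ^ Suc n)" by (rule iffD2[OF of_nat_less_iff])
        thus "int (Suc n) \<le> 2 ^ Suc n" by simp
      qed auto
      also have "\<dots> = int (2 * E\<^sup>2) ^ Suc n" by (simp add: power_mult_distrib)
      finally show ?thesis .
    qed
    moreover have "2 * E\<^sup>2 \<ge> 1" using D by (auto simp: E_def)
    ultimately show ?case by blast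
  qed
  then obtain D where D: "\<And>j. D j \<ge> 1" "\<And>j n. \<bar>(F ^ j) $ n\<bar> \<le> int (D j) ^ Suc n" by metis
  define D' where "D' = 1 + (\<Sum>j<J. D j)"
  show ?thesis
  proof
    show "D' \<ge> 1" by (simp add: D'_def)
    fix j n assume "j < J"
    hence "D j \<le> (\<Sum>j<J. D j)" by (intro member_le_sum) auto
    hence "D j \<le> D'" by (simp add: D'_def)
    hence "int (D j) ^ Suc n \<le> int D' ^ Suc n" by (intro power_mono) auto
    thus "\<bar>(F ^ j) $ n\<bar> \<le> int D' ^ Suc n" using D(2)[of j n] by linarith
  qed
qed

lemma coeff_sum_monom: "coeff (\<Sum>i<N. monom (f i) i) n = (if n < (N::nat) then f n else 0)"
  by (simp add: coeff_sum)

text \<open>There are \<open>4 * l ^ 2 * k\<close> unknown coefficients and half as many vanishing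
  conditions. The entries of the linear system have size at most \<open>D ^ (2 * l * l * k)\<close>,
  so the solution is exponential in \<open>k\<close> with a base \<open>B\<close> independent of
  \<open>k\<close>.\<close>

lemma auxiliary_polynomial:
  fixes F :: "int fps" and C l :: nat
  assumes F: "\<And>n. \<bar>F $ n\<bar> \<le> int C ^ Suc n" and l: "l \<ge> 1"
  shows "\<exists>B::nat\<ge>2. \<forall>k\<ge>1. \<exists>P. P \<noteq> 0 \<and> degree P < 2 * l \<and>
       (\<forall>j i. i \<ge> 2 * l * k \<longrightarrow> coeff (coeff P j) i = 0) \<and>
       (\<forall>j i. \<bar>coeff (coeff P j) i\<bar> \<le> int B ^ k) \<and> (\<forall>m < 2 * l * l * k. ev F P $ m = 0) \<and>
       (\<forall>m. \<bar>ev F P $ m\<bar> \<le> int B ^ (k + m))"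
proof -
  obtain D where D: "D \<ge> 1" "\<And>j n. j < 2 * l \<Longrightarrow> \<bar>(F ^ j) $ n\<bar> \<le> int D ^ Suc n"
    using fps_power_coeff_bound[OF F] by blast
  \<comment> \<open>\<open>128 * l ^ 4\<close> is \<open>32 * l ^ 4\<close>, from
    \<open>2 * card U ^ 2 = 32 * l ^ 4 * k ^ 2\<close>, times the 4 from
    \<open>k ^ 2 \<le> 4 ^ k\<close>.\<close>
  define B where "B = 128 * l ^ 4 * D ^ (2 * l * l + 1)"
  have B: "B \<ge> 2" "D \<le> B"
  proof -
    have "1 \<le> l ^ 4" "D ^ 1 \<le> D ^ (2 * l * l + 1)" using D l by (auto intro: power_increasing one_le_power)
    hence "1 * D \<le> (128 * l ^ 4) * D ^ (2 * l * l + 1)" "2 * 1 \<le> (128 * l ^ 4) * D ^ (2 * l * l + 1)"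
      using D by (intro mult_le_mono; simp)+
    thus "B \<ge> 2" "D \<le> B" by (simp_all add: B_def)
  qed
  show ?thesis
  proof (intro exI[of _ B] conjI allI impI)
    show "B \<ge> 2" by fact
    fix k :: nat assume k: "k \<ge> 1"
    define N where "N = 2 * l * k"
    define U where "U = {..<N} \<times> {..<2 * l}"
    define A where "A = D ^ (2 * l * l * k)"
    define c where "c = (\<lambda>m u. (fps_X ^ fst u * F ^ snd u) $ m)"
    have c: "\<bar>c m u\<bar> \<le> int D ^ Suc m" if "u \<in> U" for m u
    proof (cases "m < fst u")
      case False
      hence "\<bar>c m u\<bar> \<le> int D ^ Suc (m - fst u)" using D(2)[of "snd u" "m - fst u"] that
        by (auto simp: c_def U_def fps_X_power_mult_nth)
      also have "\<dots> \<le> int D ^ Suc m" using D by (intro power_increasing) auto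
      finally show ?thesis .
    qed (simp add: c_def fps_X_power_mult_nth)
    have cardU: "card U = 4 * l\<^sup>2 * k" by (simp add: U_def N_def power2_eq_square)
    have N: "N \<ge> 1" using k l by (simp add: N_def)
    obtain x where x: "\<exists>u\<in>U. x u \<noteq> 0" "\<And>u. u \<in> U \<Longrightarrow> \<bar>x u\<bar> \<le> int (2 * card U * A)"
      "\<And>m. m \<in> {..<2 * l * l * k} \<Longrightarrow> (\<Sum>u\<in>U. c m u * x u) = 0"
    proof (rule siegel_lemma[of U "{..<2 * l * l * k}" c A])
      show "U \<noteq> {}" using N l by (auto simp: U_def lessThan_empty_iff)
      show "2 * card {..<2 * l * l * k} \<le> card U" by (simp add: cardU power2_eq_square)
      show "1 \<le> A" using D by (simp add: A_def)
      fix m u assume "m \<in> {..<2 * l * l * k}" "u \<in> U"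
      hence "\<bar>c m u\<bar> \<le> int D ^ Suc m" by (intro c)
      also have "\<dots> \<le> int D ^ (2 * l * l * k)" using D \<open>m \<in> _\<close> by (intro power_increasing) auto
      finally show "\<bar>c m u\<bar> \<le> int A" by (simp add: A_def)
    qed (auto simp: U_def)
    define P where "P = (\<Sum>j<2 * l. monom (\<Sum>i<N. monom (x (i, j)) i) j)"
    have coeffP: "coeff (coeff P j) i = (if (i, j) \<in> U then x (i, j) else 0)" for i j
      by (simp add: P_def coeff_sum_monom U_def)
    have "ev F P = (\<Sum>j<2 * l. (\<Sum>i<N. fps_const (x (i, j)) * fps_X ^ i) * F ^ j)"
      by (simp add: P_def ev_sum ev_monom fps_of_poly_sum fps_of_poly_monom)
    also have "\<dots> = (\<Sum>i<N. \<Sum>j<2 * l. fps_const (x (i, j)) * (fps_X ^ i * F ^ j))"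
      by (subst sum.swap) (simp add: sum_distrib_right mult.assoc)
    also have "\<dots> = (\<Sum>u\<in>U. fps_const (x u) * (fps_X ^ fst u * F ^ snd u))"
      by (simp add: U_def sum.cartesian_product case_prod_unfold)
    finally have "ev F P $ m = (\<Sum>u\<in>U. x u * c m u)" for m
      by (simp add: fps_sum_nth c_def)
    hence evP: "ev F P $ m = (\<Sum>u\<in>U. c m u * x u)" for m by (simp add: mult.commute)
    \<comment> \<open>The surplus factor \<open>card U * D ^ k\<close> lets the same
      \<open>B\<close> bound the coefficients of \<open>ev F P\<close>, which are sums over
      \<open>U\<close>.\<close>
    have Bk: "(2 * card U * A) * (card U * D ^ k) \<le> B ^ k"
    proof -
      have kk: "k * k \<le> 4 ^ k"
      proof -
        have "k \<le> 2 ^ k" using less_exp[of k] by simp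
        hence "k * k \<le> 2 ^ k * 2 ^ k" by (intro mult_le_mono)
        thus ?thesis by (simp flip: power_mult_distrib)
      qed
      have *: "(32 * l ^ 4) * (k * k) \<le> (32 * l ^ 4) ^ k * 4 ^ k"
        using k l kk by (intro mult_le_mono self_le_power) auto
      have "(2 * card U * A) * (card U * D ^ k) = (32 * l ^ 4) * (k * k) * (D ^ (2 * l * l * k) * D ^ k)"
        by (simp add: cardU A_def power2_eq_square power4_eq_xxxx algebra_simps)
      also have "\<dots> \<le> ((32 * l ^ 4) ^ k * 4 ^ k) * (D ^ (2 * l * l * k) * D ^ k)"
        by (intro mult_le_mono1 *)
      also have "\<dots> = ((32 * l ^ 4 * 4) * (D ^ (2 * l * l) * D)) ^ k"
        by (simp only: power_mult_distrib[of "32 * l ^ 4 * 4"] power_mult_distrib[of "32 * l ^ 4" 4]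
            power_mult_distrib[of "D ^ (2 * l * l)"] power_mult[of D "2 * l * l"])
      also have "(32 * l ^ 4 * 4) * (D ^ (2 * l * l) * D) = B" by (simp add: B_def)
      finally show ?thesis .
    qed
    have "card U * D ^ k \<ge> 1" using D cardU l k by simp
    hence xB: "2 * card U * A \<le> B ^ k" using Bk by (metis le_trans mult_le_mono2 mult.right_neutral)
    show "\<exists>P. P \<noteq> 0 \<and> degree P < 2 * l \<and> (\<forall>j i. i \<ge> 2 * l * k \<longrightarrow> coeff (coeff P j) i = 0) \<and>
       (\<forall>j i. \<bar>coeff (coeff P j) i\<bar> \<le> int B ^ k) \<and> (\<forall>m < 2 * l * l * k. ev F P $ m = 0) \<and>
       (\<forall>m. \<bar>ev F P $ m\<bar> \<le> int B ^ (k + m))"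
    proof (intro exI[of _ P] conjI allI impI)
      show "P \<noteq> 0"
      proof
        assume "P = 0"
        hence "x u = 0" if "u \<in> U" for u using coeffP[of "snd u" "fst u"] that by simp
        thus False using x(1) by auto
      qed
      show "degree P < 2 * l" unfolding P_def using l
        by (intro degree_sum_less) (auto intro: le_less_trans[OF degree_monom_le])
      show "coeff (coeff P j) i = 0" if "2 * l * k \<le> i" for i j
        using that by (simp add: coeffP U_def N_def)
      show "\<bar>coeff (coeff P j) i\<bar> \<le> int B ^ k" for i j
      proof (cases "(i, j) \<in> U")
        case True
        hence "\<bar>coeff (coeff P j) i\<bar> \<le> int (2 * card U * A)" using x(2) coeffP by simp
        also have "\<dots> \<le> int (B ^ k)" using xB by (intro of_nat_mono)
        finally show ?thesis by simp
      qed (simp add: coeffP)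
      show "ev F P $ m = 0" if "m < 2 * l * l * k" for m using x(3)[of m] that by (simp add: evP)
      show "\<bar>ev F P $ m\<bar> \<le> int B ^ (k + m)" for m
      proof -
        have "\<bar>ev F P $ m\<bar> \<le> (\<Sum>u\<in>U. \<bar>c m u * x u\<bar>)" unfolding evP by (rule sum_abs)
        also have "\<dots> \<le> (\<Sum>u\<in>U. int D ^ Suc m * int (2 * card U * A))"
          unfolding abs_mult by (intro sum_mono mult_mono c x(2)) auto
        also have "\<dots> = int ((2 * card U * A) * (card U * D ^ 1) * D ^ m)" by (simp add: algebra_simps)
        also have "\<dots> \<le> int (B ^ k * B ^ m)"
        proof (intro of_nat_mono mult_le_mono)
          have "D ^ 1 \<le> D ^ k" using D k by (intro power_increasing) auto
          hence "(2 * card U * A) * (card U * D ^ 1) \<le> (2 * card U * A) * (card U * D ^ k)"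
            by (intro mult_le_mono le_refl)
          thus "(2 * card U * A) * (card U * D ^ 1) \<le> B ^ k" using Bk by linarith
          show "D ^ m \<le> B ^ m" using B by (intro power_mono) auto
        qed
        finally show ?thesis by (simp add: power_add)
      qed
    qed
  qed
qed

section \<open>Evaluation at complex points\<close>

definition peval :: "int poly poly \<Rightarrow> complex \<Rightarrow> complex \<Rightarrow> complex" where
  "peval P x y = poly (map_poly (\<lambda>q. poly (map_poly of_int q) x) P) y"

lemma peval_0 [simp]: "peval 0 x y = 0"
  by (simp add: peval_def)

lemma peval_pCons: "peval (pCons a P) x y = poly (map_poly of_int a) x + y * peval P x y"
  by (simp add: peval_def map_poly_pCons)

lemma peval_altdef:
  assumes "degree P < J" "\<And>j i. i \<ge> N \<Longrightarrow> coeff (coeff P j) i = 0"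
  shows "peval P x y = (\<Sum>j<J. \<Sum>i<N. of_int (coeff (coeff P j) i) * x ^ i * y ^ j)"
proof -
  have 1: "poly (map_poly of_int q) x = (\<Sum>i<N. of_int (coeff q i) * x ^ i)"
    if "\<And>i. i \<ge> N \<Longrightarrow> coeff q i = 0" for q :: "int poly"
  proof -
    have "poly (map_poly of_int q) x = (\<Sum>i\<le>degree q. of_int (coeff q i) * x ^ i)"
      by (simp add: poly_altdef coeff_map_poly degree_map_poly)
    also have "\<dots> = (\<Sum>i<max N (Suc (degree q)). of_int (coeff q i) * x ^ i)"
      by (rule sum.mono_neutral_left) (auto simp: coeff_eq_0)
    also have "\<dots> = (\<Sum>i<N. of_int (coeff q i) * x ^ i)"
      by (rule sum.mono_neutral_right) (auto simp: that)
    finally show ?thesis .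
  qed
  define P' where "P' = map_poly (\<lambda>q. poly (map_poly of_int q) x :: complex) P"
  have P': "coeff P' j = poly (map_poly of_int (coeff P j)) x" for j
    by (simp add: P'_def coeff_map_poly)
  have dP': "degree P' < J" using assms(1) map_poly_degree_leq[of "\<lambda>q. poly (map_poly of_int q) x" P] unfolding P'_def by simp
  have "peval P x y = (\<Sum>j\<le>degree P'. coeff P' j * y ^ j)"
    by (simp add: peval_def poly_altdef P'_def)
  also have "\<dots> = (\<Sum>j<J. coeff P' j * y ^ j)"
    using dP' by (intro sum.mono_neutral_left) (auto simp: coeff_eq_0)
  also have "\<dots> = (\<Sum>j<J. \<Sum>i<N. of_int (coeff (coeff P j) i) * x ^ i * y ^ j)"
    unfolding P' by (intro sum.cong refl, subst 1) (auto simp: assms sum_distrib_right)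
  finally show ?thesis .
qed

definition cfps :: "int fps \<Rightarrow> complex fps" where
  "cfps f = Abs_fps (\<lambda>n. of_int (f $ n))"

lemma cfps_nth [simp]: "cfps f $ n = of_int (f $ n)"
  by (simp add: cfps_def)

lemma cfps_add: "cfps (f + g) = cfps f + cfps g"
  by (simp add: fps_eq_iff)

lemma cfps_mult: "cfps (f * g) = cfps f * cfps g"
  by (simp add: fps_eq_iff fps_mult_nth)

lemma cfps_fps_of_poly: "cfps (fps_of_poly p) = fps_of_poly (map_poly of_int p)"
  by (simp add: fps_eq_iff coeff_map_poly)

text \<open>Both claims share one induction because evaluating the product with
  \<open>ev F P\<close> requires its radius of convergence.\<close>

lemma eval_cfps_ev:
  assumes "ereal (norm x) < fps_conv_radius (cfps F)"
  shows "eval_fps (cfps (ev F P)) x = peval P x (eval_fps (cfps F) x) \<and>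
    fps_conv_radius (cfps F) \<le> fps_conv_radius (cfps (ev F P))"
proof (induction P)
  case 0
  have "cfps 0 = 0" by (simp add: fps_eq_iff)
  thus ?case by simp
next
  case (pCons a P)
  have r: "fps_conv_radius (cfps F) \<le> fps_conv_radius (cfps F * cfps (ev F P))"
    using pCons fps_conv_radius_mult[of "cfps F" "cfps (ev F P)"] by (meson min.boundedI order.trans order_refl)
  have "fps_conv_radius (cfps F) \<le> fps_conv_radius (fps_of_poly (map_poly of_int a) + cfps F * cfps (ev F P))"
    using r fps_conv_radius_add[of "fps_of_poly (map_poly of_int a)" "cfps F * cfps (ev F P)"]
    by (simp add: min_def split: if_splits)
  moreover have "eval_fps (fps_of_poly (map_poly of_int a) + cfps F * cfps (ev F P)) x =
    poly (map_poly of_int a) x + eval_fps (cfps F) x * eval_fps (cfps (ev F P)) x"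
    using assms pCons r by (subst eval_fps_add; (subst eval_fps_mult)?) (auto intro: less_le_trans)
  ultimately show ?case using pCons
    by (simp add: ev_pCons cfps_add cfps_mult cfps_fps_of_poly peval_pCons)
qed

lemma sums_ev:
  assumes "ereal (norm x) < fps_conv_radius (cfps F)"
  shows "(\<lambda>n. of_int (ev F P $ n) * x ^ n) sums peval P x (eval_fps (cfps F) x)"
proof -
  have "ereal (norm x) < fps_conv_radius (cfps (ev F P))"
    using eval_cfps_ev[OF assms, of P] assms by (auto intro: less_le_trans)
  from sums_eval_fps[OF this] show ?thesis using eval_cfps_ev[OF assms, of P] by simp
qed

lemma norm_power_series_le:
  fixes a :: "nat \<Rightarrow> complex"
  assumes sums: "(\<lambda>n. a n * x ^ n) sums s" and zero: "\<And>n. n < M \<Longrightarrow> a n = 0"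
    and bound: "\<And>n. n \<ge> M \<Longrightarrow> norm (a n) \<le> A * B ^ n" and B: "0 \<le> B" "B * norm x \<le> 1 / 2" and A: "0 \<le> A"
  shows "norm s \<le> 2 * A * (B * norm x) ^ M"
proof -
  define r where "r = B * norm x"
  have r: "0 \<le> r" "r \<le> 1 / 2" using B by (auto simp: r_def)
  have "(\<lambda>n. a (n + M) * x ^ (n + M)) sums s"
    using sums zero by (subst sums_iff_shift) simp
  moreover have g: "(\<lambda>n. A * r ^ M * r ^ n) sums (A * r ^ M * (1 / (1 - r)))"
    using r by (intro sums_mult geometric_sums) auto
  moreover have "norm (a (n + M) * x ^ (n + M)) \<le> A * r ^ M * r ^ n" for n
  proof -
    have "norm (a (n + M) * x ^ (n + M)) \<le> A * B ^ (n + M) * norm x ^ (n + M)"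
      unfolding norm_mult norm_power using bound[of "n + M"] by (intro mult_right_mono) auto
    also have "\<dots> = A * r ^ M * r ^ n" by (simp add: r_def power_mult_distrib power_add algebra_simps)
    finally show ?thesis .
  qed
  ultimately have "norm s \<le> A * r ^ M * (1 / (1 - r))"
    using norm_suminf_le[of "\<lambda>n. a (n + M) * x ^ (n + M)" "\<lambda>n. A * r ^ M * r ^ n"] by (simp add: sums_iff)
  also have "\<dots> \<le> A * r ^ M * 2"
    using r A by (intro mult_left_mono) (auto simp: divide_simps)
  finally show ?thesis by (simp add: r_def)
qed

section \<open>The infinite product\<close>

text \<open>The points \<open>1 - w\<close> fill a compact part of the right half-plane, away from
  the branch cut.\<close>

lemma Ln_one_minus_bounded:
  fixes r :: real
  assumes "r < 1"
  obtains B where "B \<ge> 0" "\<And>w. norm w \<le> r \<Longrightarrow> norm (Ln (1 - w)) \<le> B"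
proof -
  have "1 - w \<notin> \<real>\<^sub>\<le>\<^sub>0" if "w \<in> cball 0 r" for w :: complex
  proof -
    have "Re w \<le> norm w" by (rule complex_Re_le_cmod)
    hence "Re (1 - w) > 0" using that assms by simp
    thus ?thesis using complex_nonpos_Reals_iff by auto
  qed
  hence "continuous_on (cball 0 r) (\<lambda>w. Ln (1 - w))" by (intro continuous_intros) auto
  hence "bounded ((\<lambda>w. Ln (1 - w)) ` cball 0 r)"
    by (intro compact_imp_bounded compact_continuous_image) auto
  then obtain B where "\<forall>w\<in>cball 0 r. norm (Ln (1 - w)) \<le> B"
    by (auto simp: bounded_iff)
  hence "norm (Ln (1 - w)) \<le> max B 0" if "norm w \<le> r" for w using that by (simp add: le_max_iff_disj)
  thus ?thesis by (intro that[of "max B 0"]) auto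
qed

definition Tterm :: "nat \<Rightarrow> nat \<Rightarrow> complex \<Rightarrow> complex" where
  "Tterm p j z = (1 / of_nat (p ^ Suc j)) * Ln (1 - z ^ (p ^ Suc j))"

lemma T_eq: "T p z = exp (- (\<Sum>j. Tterm p j z))"
  by (simp only: T_def Tterm_def)

lemma Tterm_bound:
  assumes p: "p \<ge> 2" and r: "0 \<le> r" "r < 1"
  obtains B where "\<And>j z. norm z \<le> r \<Longrightarrow> norm (Tterm p j z) \<le> B * (1 / 2) ^ j"
proof -
  obtain B where B: "B \<ge> 0" "\<And>w. norm w \<le> r \<Longrightarrow> norm (Ln (1 - w)) \<le> B"
    using Ln_one_minus_bounded[OF r(2)] by blast
  show ?thesis
  proof (rule that)
    fix j and z :: complex assume z: "norm z \<le> r"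
    have "norm (z ^ (p ^ Suc j)) \<le> norm z ^ 1"
      unfolding norm_power using z r p by (intro power_decreasing) (auto simp: Suc_le_eq)
    hence 1: "norm (Ln (1 - z ^ (p ^ Suc j))) \<le> B" using z by (intro B(2)) simp
    have "(2 :: real) ^ j \<le> 2 ^ Suc j" by simp
    also have "\<dots> \<le> real p ^ Suc j" using p by (intro power_mono) auto
    finally have "1 / real p ^ Suc j \<le> 1 / 2 ^ j" by (intro divide_left_mono) (use p in auto)
    hence "1 / real p ^ Suc j \<le> (1 / 2) ^ j" by (simp add: power_divide)
    hence "norm (1 / of_nat (p ^ Suc j) :: complex) \<le> (1 / 2) ^ j"
      by (simp add: norm_divide norm_power norm_mult)
    hence "norm (Tterm p j z) \<le> (1 / 2) ^ j * B"
      unfolding Tterm_def norm_mult using 1 by (intro mult_mono) auto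
    thus "norm (Tterm p j z) \<le> B * (1 / 2) ^ j" by (simp add: mult.commute)
  qed
qed

lemma Tterm_uniform_limit:
  assumes p: "p \<ge> 2" and r: "0 \<le> r" "r < 1"
  shows "uniform_limit (cball 0 r) (\<lambda>n z. \<Sum>j<n. Tterm p j z) (\<lambda>z. \<Sum>j. Tterm p j z) sequentially"
proof -
  obtain B where "\<And>j z. norm z \<le> r \<Longrightarrow> norm (Tterm p j z) \<le> B * (1 / 2) ^ j"
    using Tterm_bound[OF assms] by blast
  thus ?thesis by (intro Weierstrass_m_test[where M = "\<lambda>j. B * (1 / 2) ^ j"]) (auto intro!: summable_mult summable_geometric)
qed

lemma Tterm_summable:
  assumes "p \<ge> 2" "norm z < 1"
  shows "summable (\<lambda>j. Tterm p j z)"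
proof -
  obtain B where "\<And>j w. norm w \<le> norm z \<Longrightarrow> norm (Tterm p j w) \<le> B * (1 / 2) ^ j"
    using Tterm_bound[OF assms(1) norm_ge_zero assms(2)] by blast
  hence "norm (Tterm p j z) \<le> B * (1 / 2) ^ j" for j by blast
  moreover have "summable (\<lambda>j. B * (1 / 2) ^ j)" by (intro summable_mult summable_geometric) simp
  ultimately show ?thesis by (rule summable_comparison_test'[rotated, where N = 0])
qed

lemma T_holomorphic:
  assumes p: "p \<ge> 2"
  shows "T p holomorphic_on ball 0 1"
proof -
  have "(\<lambda>z. \<Sum>j. Tterm p j z) holomorphic_on ball 0 1"
  proof (rule holomorphic_uniform_sequence)
    show "open (ball 0 1 :: complex set)" by simp
    fix n
    have "1 - z ^ (p ^ Suc j) \<notin> \<real>\<^sub>\<le>\<^sub>0" if "z \<in> ball 0 1" for z :: complex and j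
    proof -
      have "Re (z ^ (p ^ Suc j)) \<le> norm (z ^ (p ^ Suc j))" by (rule complex_Re_le_cmod)
      also have "\<dots> < 1" unfolding norm_power using that p by (intro power_Suc_less_one power_less_one_iff[THEN iffD2]) auto
      finally have "Re (1 - z ^ (p ^ Suc j)) > 0" by simp
      thus ?thesis using complex_nonpos_Reals_iff by (metis linorder_not_less)
    qed
    thus "(\<lambda>z. \<Sum>j<n. Tterm p j z) holomorphic_on ball 0 1"
      unfolding Tterm_def using p by (intro holomorphic_intros) auto
  next
    fix x :: complex assume x: "x \<in> ball 0 1"
    define d where "d = (1 - norm x) / 2"
    have sub: "cball x d \<subseteq> cball 0 (norm x + d)"
    proof
      fix y assume "y \<in> cball x d"
      thus "y \<in> cball 0 (norm x + d)" using norm_triangle_ineq4[of x "x - y"] by (simp add: dist_norm)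
    qed
    have d: "d > 0" "norm x + d < 1" using x by (auto simp: d_def field_simps)
    show "\<exists>d>0. cball x d \<subseteq> ball 0 1 \<and> uniform_limit (cball x d) (\<lambda>n z. \<Sum>j<n. Tterm p j z) (\<lambda>z. \<Sum>j. Tterm p j z) sequentially"
    proof (intro exI[of _ d] conjI)
      show "cball x d \<subseteq> ball 0 1" using sub d by force
      show "uniform_limit (cball x d) (\<lambda>n z. \<Sum>j<n. Tterm p j z) (\<lambda>z. \<Sum>j. Tterm p j z) sequentially"
        using Tterm_uniform_limit[OF p, of "norm x + d"] d sub by (intro uniform_limit_on_subset[OF _ sub]) auto
    qed (fact d)
  qed
  hence "(\<lambda>z. exp (- (\<Sum>j. Tterm p j z))) holomorphic_on ball 0 1"
    by (intro holomorphic_intros)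
  thus ?thesis by (simp add: T_eq[abs_def])
qed

lemma one_minus_power_nonzero:
  fixes z :: complex
  assumes "norm z < 1" "n > 0"
  shows "1 - z ^ n \<noteq> 0"
proof
  assume "1 - z ^ n = 0"
  hence "norm (z ^ n) = 1" by simp
  thus False using assms power_less_one_iff[of "norm z" n] by (simp add: norm_power)
qed

text \<open>Multiplying the logarithmic series by \<open>p\<close> shifts its index by one and
  leaves \<open>Ln (1 - z ^ p)\<close> over. Exponentiating only afterwards avoids any choice of
  branch.\<close>

lemma T_functional_equation:
  assumes p: "p \<ge> 2" and z: "norm z < 1"
  shows "T p (z ^ p) = (1 - z ^ p) * T p z ^ p"
proof -
  have z': "norm (z ^ p) < 1" unfolding norm_power using z p power_less_one_iff[of "norm z" p] by simp
  have sm: "summable (\<lambda>j. of_nat p * Tterm p j z)" by (intro summable_mult Tterm_summable p z)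
  have "of_nat p * (\<Sum>j. Tterm p j z) = (\<Sum>j. of_nat p * Tterm p j z)"
    by (intro suminf_mult[symmetric] Tterm_summable p z)
  also have "\<dots> = (\<Sum>j. of_nat p * Tterm p (Suc j) z) + of_nat p * Tterm p 0 z"
    using suminf_split_head[OF sm] by simp
  also have "(\<lambda>j. of_nat p * Tterm p (Suc j) z) = (\<lambda>j. Tterm p j (z ^ p))"
    using p by (simp add: Tterm_def fun_eq_iff flip: power_mult)
  also have "of_nat p * Tterm p 0 z = Ln (1 - z ^ p)" using p by (simp add: Tterm_def)
  finally have eq: "of_nat p * (\<Sum>j. Tterm p j z) = (\<Sum>j. Tterm p j (z ^ p)) + Ln (1 - z ^ p)" .
  have "T p z ^ p = exp (- (of_nat p * (\<Sum>j. Tterm p j z)))"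
    unfolding T_eq by (simp flip: exp_of_nat_mult)
  also have "\<dots> = T p (z ^ p) * exp (- Ln (1 - z ^ p))" unfolding eq by (simp add: T_eq exp_add[symmetric])
  also have "exp (- Ln (1 - z ^ p)) = inverse (1 - z ^ p)"
    using one_minus_power_nonzero[OF z, of p] p by (simp add: exp_minus)
  finally show ?thesis using one_minus_power_nonzero[OF z, of p] p by (simp add: field_simps)
qed

lemma T_0: "p \<ge> 2 \<Longrightarrow> T p 0 = 1"
  by (simp add: T_eq Tterm_def power_0_left)

section \<open>Growth along radii towards roots of unity\<close>

lemma norm_T_real_ge_1:
  assumes p: "p \<ge> 2" and r: "0 \<le> r" "r < 1"
  shows "norm (T p (of_real r)) \<ge> 1"
proof -
  have nz: "norm (complex_of_real r) < 1" using r by simp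
  have sm: "summable (\<lambda>j. Tterm p j (of_real r))" by (intro Tterm_summable p nz)
  have le: "Re (Tterm p j (of_real r)) \<le> 0" for j
  proof -
    define w where "w = complex_of_real r ^ (p ^ Suc j)"
    have w: "w = of_real (r ^ (p ^ Suc j))" by (simp add: w_def)
    have "0 \<le> r ^ (p ^ Suc j)" "r ^ (p ^ Suc j) \<le> 1" using r by (auto intro: power_le_one)
    moreover have "1 - w = of_real (1 - r ^ (p ^ Suc j))" unfolding w by simp
    ultimately have "norm (1 - w) \<le> 1" by (simp only: norm_of_real abs_if) simp
    moreover have "1 - w \<noteq> 0" unfolding w_def using nz p by (intro one_minus_power_nonzero) auto
    ultimately have "Re (Ln (1 - w)) \<le> 0" by simp
    moreover have "Tterm p j (of_real r) = of_real (1 / real (p ^ Suc j)) * Ln (1 - w)"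
      by (simp add: Tterm_def w_def)
    ultimately show ?thesis by (simp add: mult_nonneg_nonpos divide_nonpos_nonneg del: power_Suc)
  qed
  have "Re (\<Sum>j. Tterm p j (of_real r)) = (\<Sum>j. Re (Tterm p j (of_real r)))"
    by (rule bounded_linear.suminf[OF bounded_linear_Re sm])
  also have "\<dots> \<le> 0"
    using suminf_le[OF le bounded_linear.summable[OF bounded_linear_Re sm] summable_zero] by simp
  finally show ?thesis by (simp add: T_eq norm_exp_eq_Re)
qed

text \<open>Each use of the functional equation costs at most a factor 2, since
  \<open>norm (1 - w ^ p) \<le> 2\<close>. Read backwards: a large value at
  \<open>z ^ (p ^ J)\<close> forces a large value at \<open>z\<close>.\<close>

lemma norm_T_power_le:
  assumes p: "p \<ge> 2"
  shows "\<exists>C>0. \<forall>z. norm z < 1 \<longrightarrow> norm (T p (z ^ (p ^ J))) \<le> C * norm (T p z) ^ (p ^ J)"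
proof (induction J)
  case 0
  show ?case by (intro exI[of _ 1]) auto
next
  case (Suc J)
  then obtain C where C: "C > 0" "\<And>z. norm z < 1 \<Longrightarrow> norm (T p (z ^ (p ^ J))) \<le> C * norm (T p z) ^ (p ^ J)"
    by blast
  have "norm (T p (z ^ (p ^ Suc J))) \<le> (2 * C ^ p) * norm (T p z) ^ (p ^ Suc J)" if z: "norm z < 1" for z
  proof -
    define w where "w = z ^ (p ^ J)"
    have w: "norm w < 1" unfolding w_def norm_power using z p power_less_one_iff[of "norm z" "p ^ J"] by simp
    have wp: "norm (w ^ p) < 1" unfolding norm_power using w p power_less_one_iff[of "norm w" p] by simp
    have "norm (T p (z ^ (p ^ Suc J))) = norm (1 - w ^ p) * norm (T p w) ^ p"
      using T_functional_equation[OF p w] by (simp add: w_def norm_mult norm_power mult.commute flip: power_mult)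
    also have "norm (1 - w ^ p) \<le> 2" using norm_triangle_ineq4[of 1 "w ^ p"] wp by simp
    hence "norm (1 - w ^ p) * norm (T p w) ^ p \<le> 2 * (C * norm (T p z) ^ (p ^ J)) ^ p"
      using C(2)[OF z] by (intro mult_mono power_mono) (auto simp: w_def)
    also have "\<dots> = (2 * C ^ p) * norm (T p z) ^ (p ^ Suc J)"
      by (simp add: power_mult_distrib mult.commute flip: power_mult)
    finally show ?thesis .
  qed
  thus ?case using C(1) by (intro exI[of _ "2 * C ^ p"]) auto
qed

text \<open>The power \<open>p ^ Suc J\<close> maps the radius through \<zeta> to the positive real
  axis, where \<open>T p\<close> has modulus at least 1. The last functional equation has the factor
  \<open>1 - r ^ n\<close>, which tends to 0, so \<open>T p\<close> blows up one step earlier, and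
  \<open>norm_T_power_le\<close> carries this back to \<open>z\<close>.\<close>

lemma T_tendsto_infinity_at_root_of_unity:
  assumes p: "p \<ge> 2" and \<zeta>: "\<zeta> ^ (p ^ Suc J) = 1"
  shows "((\<lambda>r. inverse (T p (of_real r * \<zeta>))) \<longlongrightarrow> 0) (at_left 1)"
proof -
  define n where "n = p ^ Suc J"
  have n: "n > 0" using p by (simp add: n_def)
  obtain C where C: "C > 0" "\<And>z. norm z < 1 \<Longrightarrow> norm (T p (z ^ (p ^ J))) \<le> C * norm (T p z) ^ (p ^ J)"
    using norm_T_power_le[OF p] by blast
  have n\<zeta>: "norm \<zeta> = 1" using \<zeta> n by (metis n_def norm_one norm_power norm_ge_zero power_eq_1_iff gr_implies_not0)
  have bound: "norm (inverse (T p (of_real r * \<zeta>))) ^ n \<le> C ^ p * (1 - r ^ n)" if r: "0 < r" "r < 1" for r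
  proof -
    define z where "z = of_real r * \<zeta>"
    have z: "norm z < 1" using r n\<zeta> by (simp add: z_def norm_mult)
    define w where "w = z ^ (p ^ J)"
    have w: "norm w < 1" unfolding w_def norm_power using z p power_less_one_iff[of "norm z" "p ^ J"] by simp
    have wp: "w ^ p = of_real (r ^ n)"
      using \<zeta> by (simp add: w_def z_def n_def power_mult_distrib mult.commute flip: power_mult)
    have rn: "0 \<le> r ^ n" "r ^ n < 1" using r n power_less_one_iff[of r n] by auto
    have "1 \<le> norm (T p (w ^ p))" unfolding wp by (rule norm_T_real_ge_1[OF p rn])
    also have "\<dots> = norm (1 - w ^ p) * norm (T p w) ^ p"
      using T_functional_equation[OF p w] by (simp add: norm_mult norm_power)
    also have "1 - w ^ p = of_real (1 - r ^ n)" unfolding wp by simp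
    also have "norm (of_real (1 - r ^ n) :: complex) = 1 - r ^ n" unfolding norm_of_real using rn by simp
    also have "(1 - r ^ n) * norm (T p w) ^ p \<le> (1 - r ^ n) * (C * norm (T p z) ^ (p ^ J)) ^ p"
      using C(2)[OF z] rn by (intro mult_left_mono power_mono) (auto simp: w_def)
    also have "\<dots> = C ^ p * (1 - r ^ n) * norm (T p z) ^ n"
      by (simp add: power_mult_distrib n_def mult.commute mult.left_commute flip: power_mult)
    finally have "1 \<le> C ^ p * (1 - r ^ n) * norm (T p z) ^ n" .
    moreover have "norm (T p z) > 0" by (simp add: T_eq)
    moreover have "norm (inverse (T p z)) ^ n = 1 / norm (T p z) ^ n"
      by (simp add: norm_inverse power_inverse divide_inverse)
    ultimately show ?thesis
      unfolding z_def[symmetric] by (simp only: pos_divide_le_eq zero_less_power)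
  qed
  have "((\<lambda>r. C ^ p * (1 - r ^ n)) \<longlongrightarrow> C ^ p * (1 - 1 ^ n)) (at_left 1)" by (intro tendsto_intros)
  hence lim: "((\<lambda>r. C ^ p * (1 - r ^ n)) \<longlongrightarrow> 0) (at_left 1)" by simp
  have ev: "eventually (\<lambda>r. 0 < r \<and> r < 1) (at_left (1 :: real))"
    using eventually_at_left_real[of 0 1] by (auto elim: eventually_mono)
  have "((\<lambda>r. norm (inverse (T p (of_real r * \<zeta>))) ^ n) \<longlongrightarrow> 0) (at_left 1)"
    by (rule tendsto_sandwich[OF _ _ tendsto_const lim]) (use ev bound in \<open>auto elim!: eventually_mono\<close>)
  hence "((\<lambda>r. root n (norm (inverse (T p (of_real r * \<zeta>))) ^ n)) \<longlongrightarrow> root n 0) (at_left 1)"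
    by (intro tendsto_real_root)
  hence "((\<lambda>r. norm (inverse (T p (of_real r * \<zeta>)))) \<longlongrightarrow> 0) (at_left 1)"
    using n by (simp add: real_root_power_cancel)
  thus ?thesis by (rule tendsto_norm_zero_cancel)
qed

text \<open>An algebraic function is bounded near every point where its leading coefficient does not
  vanish, whereas \<open>T p\<close> is unbounded near all roots of unity of order a power of \<open>p\<close>.\<close>
lemma T_transcendental_function:
  assumes p: "p \<ge> 2" and "c \<noteq> 0" and zero: "\<And>z. norm z < 1 \<Longrightarrow> peval P (c * z) (T p z) = 0"
  shows "P = 0"
proof (rule ccontr)
  assume "P \<noteq> 0"
  define m where "m = degree P"
  define f where "f = (\<lambda>j z. poly (map_poly of_int (coeff P j)) (c * z) :: complex)"
  have "peval P (c * z) y = (\<Sum>j\<le>m. f j z * y ^ j)" for z y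
  proof -
    have "peval P (c * z) y = (\<Sum>j\<le>degree (map_poly (\<lambda>q. poly (map_poly of_int q) (c * z)) P). f j z * y ^ j)"
      by (simp add: peval_def poly_altdef f_def coeff_map_poly)
    also have "\<dots> = (\<Sum>j\<le>m. f j z * y ^ j)"
      using map_poly_degree_leq[of "\<lambda>q. poly (map_poly of_int q) (c * z)" P]
    proof (intro sum.mono_neutral_left ballI)
      fix i assume "i \<in> {..m} - {..degree (map_poly (\<lambda>q. poly (map_poly of_int q) (c * z)) P)}"
      hence "coeff (map_poly (\<lambda>q. poly (map_poly of_int q) (c * z)) P) i = 0" by (intro coeff_eq_0) auto
      thus "f i z * y ^ i = 0" by (simp add: f_def coeff_map_poly)
    qed (auto simp: m_def)
    finally show ?thesis .
  qed
  hence rel: "(\<Sum>j\<le>m. f j z * T p z ^ j) = 0" if "norm z < 1" for z using zero[OF that] by simp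
  define q where "q = (map_poly of_int (coeff P m) :: complex poly)"
  have "coeff P m \<noteq> 0" using \<open>P \<noteq> 0\<close> by (simp add: m_def)
  hence "coeff q (degree (coeff P m)) \<noteq> 0" by (simp add: q_def coeff_map_poly)
  hence "q \<noteq> 0" by auto
  have fin: "finite {x. poly q x = 0}" using \<open>q \<noteq> 0\<close> by (rule poly_roots_finite)
  \<comment> \<open>There are \<open>p ^ Suc J > J\<close> roots of unity of this order, too many
    for all of them to be zeros of the leading coefficient.\<close>
  define J where "J = card {x. poly q x = 0}"
  define n where "n = p ^ Suc J"
  have n: "n > 0" using p by (simp add: n_def)
  have "J < n"
  proof -
    have "J < 2 ^ J" by (rule less_exp)
    also have "\<dots> \<le> p ^ J" using p by (intro power_mono) auto
    also have "\<dots> \<le> n" using p by (simp add: n_def)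
    finally show ?thesis .
  qed
  have "\<exists>\<zeta>. \<zeta> ^ n = 1 \<and> poly q (c * \<zeta>) \<noteq> 0"
  proof (rule ccontr)
    assume "\<not> ?thesis"
    hence "(\<lambda>x. c * x) ` {\<zeta>. \<zeta> ^ n = 1} \<subseteq> {x. poly q x = 0}" by auto
    hence "card ((\<lambda>x. c * x) ` {\<zeta>. \<zeta> ^ n = 1}) \<le> J" unfolding J_def by (intro card_mono fin)
    moreover have "card ((\<lambda>x. c * x) ` {\<zeta>. \<zeta> ^ n = 1}) = card {\<zeta> :: complex. \<zeta> ^ n = 1}"
      using \<open>c \<noteq> 0\<close> by (intro card_image) (auto simp: inj_on_def)
    moreover have "card {\<zeta> :: complex. \<zeta> ^ n = 1} = n" using n by (rule card_roots_unity_eq)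
    ultimately show False using \<open>J < n\<close> by linarith
  qed
  then obtain \<zeta> where \<zeta>: "\<zeta> ^ n = 1" "poly q (c * \<zeta>) \<noteq> 0" by blast
  have n\<zeta>: "norm \<zeta> = 1" using \<zeta> n by (metis norm_one norm_power norm_ge_zero power_eq_1_iff gr_implies_not0)
  define u where "u = (\<lambda>r. inverse (T p (of_real r * \<zeta>)))"
  have u: "(u \<longlongrightarrow> 0) (at_left 1)"
    unfolding u_def using T_tendsto_infinity_at_root_of_unity[OF p] \<zeta>(1) n_def by blast
  have lim_f: "((\<lambda>r. f j (of_real r * \<zeta>)) \<longlongrightarrow> f j (of_real 1 * \<zeta>)) (at_left 1)" for j
    unfolding f_def by (intro tendsto_intros)
  \<comment> \<open>The relation divided by \<open>T p z ^ m\<close>; in the limit only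
    \<open>j = m\<close> survives, because \<open>0 ^ 0 = 1\<close>.\<close>
  have "((\<lambda>r. \<Sum>j\<le>m. f j (of_real r * \<zeta>) * u r ^ (m - j)) \<longlongrightarrow> (\<Sum>j\<le>m. f j (of_real 1 * \<zeta>) * 0 ^ (m - j))) (at_left 1)"
    by (intro tendsto_intros lim_f u)
  also have "(\<Sum>j\<le>m. f j (of_real 1 * \<zeta>) * 0 ^ (m - j)) = (\<Sum>j\<le>m. if j = m then f m \<zeta> else 0)"
    by (intro sum.cong) auto
  also have "\<dots> = poly q (c * \<zeta>)" by (simp add: f_def q_def)
  finally have lim1: "((\<lambda>r. \<Sum>j\<le>m. f j (of_real r * \<zeta>) * u r ^ (m - j)) \<longlongrightarrow> poly q (c * \<zeta>)) (at_left 1)" .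
  have "(\<Sum>j\<le>m. f j (of_real r * \<zeta>) * u r ^ (m - j)) = 0" if r: "0 < r" "r < 1" for r
  proof -
    define z where "z = of_real r * \<zeta>"
    have z: "norm z < 1" using r n\<zeta> by (simp add: z_def norm_mult)
    have nz: "T p z \<noteq> 0" by (simp add: T_eq)
    have "(\<Sum>j\<le>m. f j z * u r ^ (m - j)) = (\<Sum>j\<le>m. f j z * T p z ^ j) * u r ^ m"
      unfolding sum_distrib_right
    proof (intro sum.cong refl)
      fix j assume "j \<in> {..m}"
      hence "u r ^ m = u r ^ j * u r ^ (m - j)" by (simp flip: power_add)
      moreover have "T p z ^ j * u r ^ j = 1" using nz by (simp add: u_def z_def flip: power_mult_distrib)
      ultimately show "f j z * u r ^ (m - j) = f j z * T p z ^ j * u r ^ m" by simp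
    qed
    thus ?thesis using rel[OF z] by (simp add: z_def)
  qed
  moreover have "eventually (\<lambda>r. 0 < r \<and> r < 1) (at_left (1 :: real))"
    using eventually_at_left_real[of 0 1] by (auto elim: eventually_mono)
  ultimately have "eventually (\<lambda>r. (\<Sum>j\<le>m. f j (of_real r * \<zeta>) * u r ^ (m - j)) = 0) (at_left 1)"
    by (auto elim!: eventually_mono)
  hence "((\<lambda>r. \<Sum>j\<le>m. f j (of_real r * \<zeta>) * u r ^ (m - j)) \<longlongrightarrow> 0) (at_left 1)"
    by (rule tendsto_eventually)
  with lim1 have "poly q (c * \<zeta>) = 0" by (intro tendsto_unique[OF _ lim1]) auto
  thus False using \<zeta> by simp
qed

section \<open>Integrality of the Taylor coefficients\<close>

definition int_upto :: "nat \<Rightarrow> complex fps \<Rightarrow> bool" where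
  "int_upto n f \<longleftrightarrow> (\<forall>i<n. f $ i \<in> \<int>)"

lemma int_upto_mult: "int_upto n f \<Longrightarrow> int_upto n g \<Longrightarrow> int_upto n (f * g)"
  unfolding int_upto_def fps_mult_nth by (auto intro!: Ints_sum Ints_mult)

lemma int_upto_const: "c \<in> \<int> \<Longrightarrow> int_upto n (fps_const c)"
  by (auto simp: int_upto_def)

lemma int_upto_power: "int_upto n f \<Longrightarrow> int_upto n (f ^ k)"
  by (induction k) (simp add: int_upto_def, simp add: int_upto_mult)

lemma int_upto_sum: "(\<And>i. i \<in> I \<Longrightarrow> int_upto n (f i)) \<Longrightarrow> int_upto n (sum f I)"
  unfolding int_upto_def by (auto simp: fps_sum_nth intro!: Ints_sum)

text \<open>For \<open>x = p * U\<close> the linear term and the remainder both carry the factor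
  \<open>p ^ 2\<close>, which can then be cancelled.\<close>

lemma power_one_plus_expansion:
  fixes x :: "'a :: comm_ring_1"
  assumes "p \<ge> 2"
  shows "(1 + x) ^ p = 1 + of_nat p * x + x\<^sup>2 * (\<Sum>c<p - 1. of_nat (p choose (c + 2)) * x ^ c)"
proof -
  obtain q where q: "p = Suc (Suc q)" using assms by (metis Suc_le_D numeral_2_eq_2 Suc_le_mono)
  have "(1 + x) ^ p = (\<Sum>c\<le>p. of_nat (p choose c) * x ^ c)"
    using binomial_ring[of x 1 p] by (simp add: add.commute)
  also have "\<dots> = (\<Sum>c<Suc (Suc (Suc q)). of_nat (p choose c) * x ^ c)"
    by (simp only: q lessThan_Suc_atMost)
  also have "\<dots> = 1 + of_nat p * x + (\<Sum>c<p - 1. of_nat (p choose (c + 2)) * x ^ (c + 2))"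
    unfolding sum.lessThan_Suc_shift[of _ "Suc (Suc q)"] sum.lessThan_Suc_shift[of _ "Suc q"] by (simp add: q)
  also have "(\<Sum>c<p - 1. of_nat (p choose (c + 2)) * x ^ (c + 2)) = x\<^sup>2 * (\<Sum>c<p - 1. of_nat (p choose (c + 2)) * x ^ c)"
    by (simp add: sum_distrib_left power_add algebra_simps power2_eq_square)
  finally show ?thesis .
qed

text \<open>Comparing \<open>n\<close>-th coefficients in the functional equation, the linear term of
  \<open>(1 + p U) ^ p\<close> determines the \<open>n\<close>-th coefficient of \<open>U\<close> from earlier ones.\<close>
lemma integral_coeffs_from_functional_equation:
  fixes S :: "complex fps" and p :: nat
  assumes p: "p \<ge> 2" and S0: "S $ 0 = 1"
    and eq: "S ^ p * (1 - fps_const (of_nat p ^ (2 * p)) * fps_X ^ p) =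
      fps_compose S (fps_const (of_nat p ^ (2 * p - 2)) * fps_X ^ p)"
  shows "S $ n \<in> \<int>"
proof -
  let ?p = "of_nat p :: complex"
  have p0: "?p \<noteq> 0" using p by simp
  \<comment> \<open>The induction needs the stronger claim that the non-constant coefficients of
    \<open>S\<close> are divisible by \<open>p\<close>.\<close>
  define U where "U = fps_const (inverse ?p) * (S - 1)"
  have SU: "S = 1 + fps_const ?p * U" using p0 by (simp add: U_def fps_eq_iff mult.assoc[symmetric])
  have U0: "U $ 0 = 0" by (simp add: U_def S0)
  have "U $ n \<in> \<int>" for n
  proof (induction n rule: less_induct)
    case (less n)
    show ?case
    proof (cases "n = 0")
      case False
      have IU: "int_upto n U" using less by (auto simp: int_upto_def)
      have IS: "int_upto n S" unfolding SU using IU by (auto simp: int_upto_def)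
      define c where "c = ?p ^ (2 * p - 2)"
      have c: "c = ?p\<^sup>2 * ?p ^ (2 * p - 4)" unfolding c_def power_add[symmetric] using p by (intro arg_cong[of _ _ "(^) ?p"]) simp
      have "\<exists>t\<in>\<int>. fps_compose S (fps_const c * fps_X ^ p) $ n = ?p\<^sup>2 * t"
      proof -
        have coeff: "((fps_const c * fps_X ^ p) ^ i) $ n = (if n = p * i then c ^ i else 0)" for i
          by (simp add: power_mult_distrib fps_const_power flip: power_mult)
        have "\<exists>t\<in>\<int>. S $ i * ((fps_const c * fps_X ^ p) ^ i) $ n = ?p\<^sup>2 * t" if "i \<in> {0..n}" for i
        proof (cases "n = p * i")
          \<comment> \<open>Only the index \<open>i\<close> with \<open>p * i = n\<close>
            contributes. As \<open>n > 0\<close>, it satisfies \<open>0 < i < n\<close>, so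
            \<open>S $ i\<close> is known to be integral and \<open>c ^ i\<close> supplies
            \<open>p ^ 2\<close>.\<close>
          case True
          obtain j where j: "i = Suc j" using True False by (cases i) auto
          have "1 * i < p * i" using p j by (intro mult_less_mono1) auto
          hence "i < n" using True by simp
          hence "S $ i \<in> \<int>" using IS by (auto simp: int_upto_def)
          moreover have "c ^ i = ?p\<^sup>2 * (?p ^ (2 * p - 4) * c ^ j)"
            unfolding j power_Suc using c by simp
          ultimately show ?thesis unfolding coeff
            by (intro bexI[of _ "?p ^ (2 * p - 4) * c ^ j * S $ i"]) (auto simp: c_def True)
        next
          case False
          thus ?thesis unfolding coeff by (intro bexI[of _ 0]) auto
        qed
        then obtain t where t: "\<And>i. i \<in> {0..n} \<Longrightarrow> t i \<in> \<int>"
          "\<And>i. i \<in> {0..n} \<Longrightarrow> S $ i * ((fps_const c * fps_X ^ p) ^ i) $ n = ?p\<^sup>2 * t i" by metis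
        have "fps_compose S (fps_const c * fps_X ^ p) $ n = ?p\<^sup>2 * (\<Sum>i=0..n. t i)"
          by (simp add: fps_compose_nth t(2) sum_distrib_left)
        thus ?thesis using t(1) by blast
      qed
      then obtain t where t: "t \<in> \<int>" "fps_compose S (fps_const c * fps_X ^ p) $ n = ?p\<^sup>2 * t" by blast
      have "S ^ p = fps_compose S (fps_const c * fps_X ^ p) + fps_const (?p ^ (2 * p)) * (fps_X ^ p * S ^ p)"
        using eq by (simp add: c_def algebra_simps)
      from arg_cong[OF this, of "\<lambda>f. fps_nth f n"] have Spn: "(S ^ p) $ n = ?p\<^sup>2 * t + ?p ^ (2 * p) * (if n < p then 0 else (S ^ p) $ (n - p))"
        by (simp add: t fps_X_power_mult_nth)
      define G where "G = (\<Sum>c<p - 1. of_nat (p choose (c + 2)) * (fps_const ?p * U) ^ c)"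
      have IG: "int_upto n G" unfolding G_def
        by (intro int_upto_sum int_upto_mult int_upto_power IU)
          (auto intro!: int_upto_const simp flip: fps_of_nat)
      \<comment> \<open>Since \<open>U\<close> has no constant term, the \<open>n\<close>-th
        coefficient of \<open>U ^ 2 * G\<close> involves only coefficients of \<open>U\<close> below
        \<open>n\<close>.\<close>
      define V where "V = fps_shift 1 U"
      have UV: "U = fps_X * V" using U0 by (simp add: V_def fps_eq_iff)
      have IV: "int_upto (n - 1) V" using IU by (auto simp: V_def int_upto_def)
      have "S ^ p = 1 + fps_const (?p\<^sup>2) * U + fps_const (?p\<^sup>2) * (U\<^sup>2 * G)"
        unfolding SU G_def by (subst power_one_plus_expansion[OF p])
          (simp add: power_mult_distrib power2_eq_square algebra_simps flip: fps_of_nat fps_const_mult)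
      hence "(S ^ p) $ n = ?p\<^sup>2 * U $ n + ?p\<^sup>2 * (U\<^sup>2 * G) $ n" using False by simp
      hence "?p\<^sup>2 * U $ n = ?p\<^sup>2 * t + ?p ^ (2 * p) * (if n < p then 0 else (S ^ p) $ (n - p)) - ?p\<^sup>2 * (U\<^sup>2 * G) $ n"
        using Spn by simp
      also have "?p ^ (2 * p) = ?p\<^sup>2 * ?p ^ (2 * p - 2)"
        unfolding power_add[symmetric] using p by (intro arg_cong[of _ _ "(^) ?p"]) simp
      finally have "?p\<^sup>2 * U $ n = ?p\<^sup>2 * (t + ?p ^ (2 * p - 2) * (if n < p then 0 else (S ^ p) $ (n - p)) - (U\<^sup>2 * G) $ n)"
        by (simp add: algebra_simps)
      hence "U $ n = t + ?p ^ (2 * p - 2) * (if n < p then 0 else (S ^ p) $ (n - p)) - (U\<^sup>2 * G) $ n"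
        using p0 by simp
      moreover have "(if n < p then 0 else (S ^ p) $ (n - p)) \<in> \<int>"
        using int_upto_power[OF IS, of p] p False by (auto simp: int_upto_def)
      moreover have "(U\<^sup>2 * G) $ n \<in> \<int>"
      proof -
        have "U\<^sup>2 * G = fps_X ^ 2 * (V * V * G)" by (simp add: UV power2_eq_square algebra_simps)
        hence *: "(U\<^sup>2 * G) $ n = (if n < 2 then 0 else (V * V * G) $ (n - 2))"
          by (simp only: fps_X_power_mult_nth)
        have "int_upto (n - 1) (V * V * G)"
          using IG by (intro int_upto_mult IV) (auto simp: int_upto_def)
        thus ?thesis unfolding * by (auto simp: int_upto_def)
      qed
      ultimately show ?thesis using t(1) by (auto intro!: Ints_add Ints_diff Ints_mult)
    qed (simp add: U0)
  qed
  thus ?thesis unfolding SU by (cases "n = 0") auto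
qed

lemma T_integral_expansion:
  assumes p: "p \<ge> 2"
  obtains F :: "int fps" and C :: nat where
    "fps_conv_radius (cfps F) \<ge> ereal (1 / real p ^ 2)"
    "\<And>x. norm x < 1 / real p ^ 2 \<Longrightarrow> eval_fps (cfps F) x = T p (of_nat p ^ 2 * x)"
    "\<And>n. \<bar>F $ n\<bar> \<le> int C ^ Suc n"
proof -
  let ?p = "of_nat p :: complex"
  define r where "r = 1 / real p ^ 2"
  have r: "r > 0" using p by (simp add: r_def)
  define g where "g = (\<lambda>x. T p (?p ^ 2 * x))"
  have in_ball: "norm (?p ^ 2 * x) < 1" if "norm x < r" for x
    using that p by (simp add: r_def norm_mult norm_power field_simps)
  have "T p \<circ> (\<lambda>x. ?p ^ 2 * x) holomorphic_on ball 0 r"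
    using in_ball by (intro holomorphic_on_compose_gen[OF _ T_holomorphic[OF p]] holomorphic_intros) auto
  hence hol: "g holomorphic_on ball 0 r" by (simp add: g_def o_def)
  hence hol': "g holomorphic_on eball 0 (ereal r)" by simp
  define S where "S = fps_expansion g 0"
  have rad: "fps_conv_radius S \<ge> ereal r" unfolding S_def by (rule conv_radius_fps_expansion[OF hol'])
  have eval: "eval_fps S x = g x" if "norm x < r" for x
    using eval_fps_expansion'[OF hol', of x] that by (simp add: S_def)
  have exp: "g has_fps_expansion S" unfolding S_def
    using hol r by (intro has_fps_expansion_fps_expansion[of "ball 0 r"]) auto
  have S0: "S $ 0 = 1" using eval[of 0] r T_0[OF p] by (simp add: g_def eval_fps_at_0)
  have "S ^ p * (1 - fps_const (?p ^ (2 * p)) * fps_X ^ p) =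
      fps_compose S (fps_const (?p ^ (2 * p - 2)) * fps_X ^ p)"
  proof (rule fps_expansion_unique_complex)
    show "(\<lambda>x. g x ^ p * (1 - ?p ^ (2 * p) * x ^ p)) has_fps_expansion S ^ p * (1 - fps_const (?p ^ (2 * p)) * fps_X ^ p)"
      by (intro fps_expansion_intros exp)
    have "(g \<circ> (\<lambda>x. ?p ^ (2 * p - 2) * x ^ p)) has_fps_expansion fps_compose S (fps_const (?p ^ (2 * p - 2)) * fps_X ^ p)"
      using p by (intro has_fps_expansion_compose exp fps_expansion_intros) auto
    moreover have "eventually (\<lambda>x. g (?p ^ (2 * p - 2) * x ^ p) = g x ^ p * (1 - ?p ^ (2 * p) * x ^ p)) (nhds 0)"
    proof -
      have "eventually (\<lambda>x. x \<in> ball 0 r) (nhds (0 :: complex))" using r by (intro eventually_nhds_in_open) auto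
      thus ?thesis
      proof eventually_elim
        case (elim x)
        hence z: "norm (?p ^ 2 * x) < 1" by (intro in_ball) simp
        have "?p ^ 2 * ?p ^ (2 * p - 2) = ?p ^ (2 * p)" unfolding power_add[symmetric] using p by (intro arg_cong[of _ _ "(^) ?p"]) simp
        hence "g (?p ^ (2 * p - 2) * x ^ p) = T p ((?p ^ 2 * x) ^ p)"
          by (simp add: g_def power_mult_distrib mult.assoc[symmetric] flip: power_mult)
        thus ?case using T_functional_equation[OF p z]
          by (simp add: g_def power_mult_distrib flip: power_mult)
      qed
    qed
    ultimately show "(\<lambda>x. g x ^ p * (1 - ?p ^ (2 * p) * x ^ p)) has_fps_expansion fps_compose S (fps_const (?p ^ (2 * p - 2)) * fps_X ^ p)"
      by (subst has_fps_expansion_cong[OF _ refl, of _ "g \<circ> (\<lambda>x. ?p ^ (2 * p - 2) * x ^ p)"]) (auto elim: eventually_mono)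
  qed
  hence SZ: "S $ n \<in> \<int>" for n by (rule integral_coeffs_from_functional_equation[OF p S0])
  define F where "F = Abs_fps (\<lambda>n. \<lfloor>Re (S $ n)\<rfloor>)"
  have cF: "cfps F = S" unfolding fps_eq_iff
  proof
    fix n obtain k where "S $ n = of_int k" using SZ[of n] by (auto elim: Ints_cases)
    thus "cfps F $ n = S $ n" by (simp add: F_def)
  qed
  \<comment> \<open>Convergence at the single point \<open>r / 2\<close> bounds the coefficients by
    \<open>M * (2 / r) ^ n\<close>; the exponent \<open>Suc n\<close> in the claim absorbs
    \<open>M\<close>.\<close>
  have "summable (\<lambda>n. S $ n * of_real (r / 2) ^ n)"
    using rad r by (intro summable_fps) (auto intro: less_le_trans[of _ "ereal r"])
  hence "Bseq (\<lambda>n. S $ n * of_real (r / 2) ^ n)"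
    by (intro convergent_imp_Bseq) (auto dest: summable_LIMSEQ_zero simp: convergent_def)
  then obtain M where M: "M > 0" "\<And>n. norm (S $ n * of_real (r / 2) ^ n) \<le> M" by (auto simp: Bseq_def)
  define C where "C = nat \<lceil>max M (2 / r)\<rceil>"
  have C: "M \<le> real C" "2 / r \<le> real C" using M r by (simp_all add: C_def, linarith+)
  show ?thesis
  proof (rule that[of F C])
    show "fps_conv_radius (cfps F) \<ge> ereal (1 / real p ^ 2)" using rad by (simp add: cF r_def)
    show "eval_fps (cfps F) x = T p (?p ^ 2 * x)" if "norm x < 1 / real p ^ 2" for x
      using eval[of x] that by (simp add: cF r_def g_def)
    fix n
    have "norm (S $ n) * (r / 2) ^ n \<le> M" using M(2)[of n] r by (simp add: norm_mult norm_power)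
    hence "norm (S $ n) \<le> M * (2 / r) ^ n" using r by (simp add: field_simps)
    also have "\<dots> \<le> real C * real C ^ n" using C M r by (intro mult_mono power_mono) auto
    finally have "norm (S $ n) \<le> real C ^ Suc n" by simp
    moreover have "norm (S $ n) = real_of_int \<bar>F $ n\<bar>" by (simp flip: cF)
    ultimately have "real_of_int \<bar>F $ n\<bar> \<le> real_of_int (int C ^ Suc n)" by simp
    thus "\<bar>F $ n\<bar> \<le> int C ^ Suc n" by (simp only: of_int_le_iff)
  qed
qed

lemma T_integral_expansion_transcendental:
  assumes p: "p \<ge> 2" and rad: "fps_conv_radius (cfps F) \<ge> ereal (1 / real p ^ 2)"
    and eval: "\<And>x. norm x < 1 / real p ^ 2 \<Longrightarrow> eval_fps (cfps F) x = T p (of_nat p ^ 2 * x)"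
  shows "transcendental_fps F"
proof
  fix P :: "int poly poly" assume "P \<noteq> 0"
  show "ev F P \<noteq> 0"
  proof
    assume ev0: "ev F P = 0"
    have "P = 0"
    proof (rule T_transcendental_function[OF p, of "inverse (of_nat p ^ 2)"])
      fix z :: complex assume z: "norm z < 1"
      define x where "x = inverse (of_nat p ^ 2) * z"
      have zx: "z = of_nat p ^ 2 * x" using p by (simp add: x_def)
      have x: "norm x < 1 / real p ^ 2" using z p by (simp add: x_def norm_mult norm_inverse norm_power norm_divide field_simps)
      hence "ereal (norm x) < fps_conv_radius (cfps F)" using rad by (auto intro: less_le_trans[of _ "ereal (1 / real p ^ 2)"])
      from sums_ev[OF this, of P] have "(\<lambda>n. 0) sums peval P x (eval_fps (cfps F) x)" by (simp add: ev0)
      hence "peval P x (eval_fps (cfps F) x) = 0" by (metis sums_unique2 sums_zero)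
      thus "peval P (inverse (of_nat p ^ 2) * z) (T p z) = 0"
        by (simp add: eval[OF x] zx[symmetric]) (simp add: x_def)
    qed (use p in auto)
    thus False using \<open>P \<noteq> 0\<close> by simp
  qed
qed

section \<open>Transcendence of the values\<close>

text \<open>A step multiplies the degree by \<open>p\<close> and adds \<open>p ^ Suc k\<close> for
  the new factor, which sums to \<open>Suc k * p ^ k\<close>. The length is raised to the power
  \<open>p\<close> and doubled; the \<open>- 1\<close> in its exponent pays for the doubling, as
  \<open>1 - p \<le> - 1\<close>.\<close>

lemma rep_T_power:
  assumes p: "p \<ge> 2" and \<alpha>: "norm \<alpha> < 1"
  shows "rep \<alpha> (T p \<alpha>) (Suc k * p ^ k) (2 ^ (2 * p ^ k - 1)) (T p (\<alpha> ^ (p ^ k)))"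
proof (induction k)
  case 0
  show ?case using rep_monomial[of 1 0 1 1 \<alpha> "T p \<alpha>"] by (auto intro: rep_mono)
next
  case (Suc k)
  define q where "q = p ^ k"
  have q: "q \<ge> 1" using p by (simp add: q_def)
  define y where "y = T p (\<alpha> ^ q)"
  have n: "norm (\<alpha> ^ q) < 1" unfolding norm_power using \<alpha> q power_less_one_iff[of "norm \<alpha>" q] by simp
  have y: "T p (\<alpha> ^ (p ^ Suc k)) = (1 - \<alpha> ^ (p * q)) * y ^ p"
    using T_functional_equation[OF p n] by (simp add: y_def q_def mult.commute flip: power_mult)
  have "rep \<alpha> (T p \<alpha>) (p * q) (1 + 1) (1 * \<alpha> ^ 0 * T p \<alpha> ^ 0 + (-1) * \<alpha> ^ (p * q) * T p \<alpha> ^ 0)"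
    by (intro rep_add rep_monomial) auto
  hence 1: "rep \<alpha> (T p \<alpha>) (p * q) 2 (1 - \<alpha> ^ (p * q))" by (simp add: numeral_2_eq_2)
  have "rep \<alpha> (T p \<alpha>) (p * (Suc k * q)) ((2 ^ (2 * q - 1)) ^ p) (y ^ p)"
    using Suc.IH by (intro rep_power) (simp add: y_def q_def)
  from rep_mult[OF 1 this] have "rep \<alpha> (T p \<alpha>) (p * q + p * (Suc k * q)) (2 * (2 ^ (2 * q - 1)) ^ p) (T p (\<alpha> ^ (p ^ Suc k)))"
    unfolding y .
  thus ?case
  proof (rule rep_mono)
    show "p * q + p * (Suc k * q) \<le> Suc (Suc k) * p ^ Suc k" by (simp add: q_def algebra_simps)
    have "Suc ((2 * q - 1) * p) + p = Suc (2 * q * p)"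
      using q by (simp add: algebra_simps diff_mult_distrib)
    hence "Suc ((2 * q - 1) * p) \<le> 2 * p ^ Suc k - 1" using p by (simp add: q_def mult.commute)
    hence "(2 :: nat) ^ Suc ((2 * q - 1) * p) \<le> 2 ^ (2 * p ^ Suc k - 1)" by (intro power_increasing) auto
    thus "2 * (2 ^ (2 * q - 1)) ^ p \<le> (2 :: nat) ^ (2 * p ^ Suc k - 1)" by (simp add: power_mult)
  qed
qed

text \<open>The left-hand side compares the Liouville bound with the smallness of the auxiliary function;
  its exponent of size \<open>k * p ^ k\<close> is negative as soon as \<open>l\<close> is large, because the order of vanishing
  is quadratic in \<open>l\<close> while the degrees are linear in \<open>l\<close>.\<close>
lemma eventually_below_liouville_bound:
  fixes a :: real and B K p l :: nat
  assumes a: "0 < a" "a < 1" and K: "K \<ge> 1" and B: "B \<ge> 1" and p: "p \<ge> 2" and l: "l \<ge> 1"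
    and small: "real K ^ 6 * a ^ (2 * l) \<le> 1 / 2"
  shows "\<exists>k0. \<forall>k\<ge>k0. real p ^ (4 * l * k) * (2 * real B ^ k * (real B * a ^ (p ^ k)) ^ (2 * l * l * k)) *
     (real K * real (4 * l * l * k * B ^ k * p ^ (4 * l * k) * 16 ^ (l * p ^ k)) ^ K * real K ^ (6 * l * k * p ^ k)) < 1"
proof -
  \<comment> \<open>\<open>A\<close> and \<open>D\<close> collect the bases of all factors that grow
    only like a \<open>k\<close>-th power and are negligible against exponents
    \<open>k * p ^ k\<close>.\<close>
  define A where "A = 4 * l * l * 2 * B * p ^ (4 * l)"
  define D where "D = p ^ (4 * l) * 2 * B * B ^ (2 * l * l) * K * A ^ K"
  have D: "D \<le> 2 ^ D" using less_exp[of D] by simp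
  show ?thesis
  proof (intro exI allI impI)
    \<comment> \<open>Half of \<open>k * q\<close> pays for \<open>D ^ k\<close>, by
      \<open>2 * D \<le> k < q\<close>, the other half for \<open>16 ^ (l * q * K)\<close>, by
      \<open>8 * l * K \<le> k\<close>.\<close>
    fix k assume k: "k \<ge> max 1 (max (8 * l * K) (2 * D))"
    define q where "q = p ^ k"
    have kq: "k < q"
    proof -
      have "k < 2 ^ k" by (rule less_exp)
      also have "\<dots> \<le> q" unfolding q_def using p by (intro power_mono) auto
      finally show ?thesis .
    qed
    define S where "S = 4 * l * l * k * B ^ k * p ^ (4 * l * k) * 16 ^ (l * q)"
    have S: "S \<le> A ^ k * 16 ^ (l * q)"
    proof -
      have "4 * l * l \<le> (4 * l * l) ^ k" using k l by (intro self_le_power) auto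
      moreover have "k \<le> 2 ^ k" using less_exp[of k] by simp
      ultimately have "(4 * l * l) * k \<le> (4 * l * l) ^ k * 2 ^ k" by (intro mult_le_mono)
      hence "(4 * l * l * k) * (B ^ k * p ^ (4 * l * k) * 16 ^ (l * q)) \<le>
         ((4 * l * l) ^ k * 2 ^ k) * (B ^ k * p ^ (4 * l * k) * 16 ^ (l * q))" by (intro mult_le_mono1)
      also have "\<dots> = A ^ k * 16 ^ (l * q)"
        unfolding A_def power_mult[of p "4 * l" k] by (simp only: power_mult_distrib mult.assoc)
      finally show ?thesis by (simp add: S_def mult.assoc)
    qed
    have SK: "real S ^ K \<le> (real A ^ K) ^ k * 16 ^ (l * q * K)"
    proof -
      have "S ^ K \<le> (A ^ k * 16 ^ (l * q)) ^ K" using S by (intro power_mono) auto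
      also have "\<dots> = (A ^ K) ^ k * 16 ^ (l * q * K)"
        by (simp only: power_mult_distrib power_mult[symmetric] mult.commute[of k K])
      finally have "real (S ^ K) \<le> real ((A ^ K) ^ k * 16 ^ (l * q * K))" by (rule of_nat_mono)
      thus ?thesis by simp
    qed
    have "2 \<le> (2 :: real) ^ k" "real K \<le> real K ^ k" using k K by (auto intro!: self_le_power)
    \<comment> \<open>Everything raised to the power \<open>k * q\<close>: the Liouville degree
      against the order of vanishing. It is the \<open>l\<close>-th power of the quantity in
      \<open>small\<close>.\<close>
    define c where "c = real K ^ (6 * l) * a ^ (2 * l * l)"
    have c: "0 \<le> c" "c \<le> 1 / 2"
    proof -
      show "0 \<le> c" using a by (simp add: c_def)
      have "c = (real K ^ 6 * a ^ (2 * l)) ^ l" by (simp only: c_def power_mult_distrib power_mult)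
      also have "\<dots> \<le> (real K ^ 6 * a ^ (2 * l)) ^ 1" using l small a by (intro power_decreasing) auto
      finally show "c \<le> 1 / 2" using small by simp
    qed
    have "real p ^ (4 * l * k) * (2 * real B ^ k * (real B * a ^ q) ^ (2 * l * l * k)) *
       (real K * real S ^ K * real K ^ (6 * l * k * q)) \<le>
      real p ^ (4 * l * k) * (2 ^ k * real B ^ k * (real B * a ^ q) ^ (2 * l * l * k)) *
       (real K ^ k * ((real A ^ K) ^ k * 16 ^ (l * q * K)) * real K ^ (6 * l * k * q))"
      using SK \<open>2 \<le> 2 ^ k\<close> \<open>real K \<le> real K ^ k\<close> a by (intro mult_mono) auto
    also have "\<dots> = (real p ^ (4 * l) * 2 * real B * real B ^ (2 * l * l) * real K * real A ^ K) ^ k *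
        16 ^ (l * q * K) * c ^ (k * q)"
    proof -
      have "real p ^ (4 * l * k) = (real p ^ (4 * l)) ^ k" by (simp only: power_mult)
      moreover have "(real B * a ^ q) ^ (2 * l * l * k) = (real B ^ (2 * l * l)) ^ k * (a ^ (2 * l * l)) ^ (k * q)"
        unfolding power_mult_distrib power_mult[symmetric] by (simp only: mult_ac)
      moreover have "real K ^ (6 * l * k * q) = (real K ^ (6 * l)) ^ (k * q)"
        unfolding power_mult[symmetric] by (simp only: mult_ac)
      ultimately show ?thesis unfolding c_def power_mult_distrib by (simp only: mult_ac)
    qed
    also have "real p ^ (4 * l) * 2 * real B * real B ^ (2 * l * l) * real K * real A ^ K = real D"
      by (simp add: D_def)
    also have "real D ^ k * 16 ^ (l * q * K) * c ^ (k * q) \<le> (2 ^ D) ^ k * 16 ^ (l * q * K) * (1 / 2) ^ (k * q)"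
    proof (intro mult_mono power_mono)
      have "real D \<le> real (2 ^ D)" using D by (rule of_nat_mono)
      thus "real D \<le> 2 ^ D" by simp
    qed (use c in auto)
    also have "\<dots> = 2 ^ (D * k + 4 * (l * q * K)) / 2 ^ (k * q)"
    proof -
      have "(16 :: real) ^ (l * q * K) = 2 ^ (4 * (l * q * K))" by (simp add: power_mult)
      thus ?thesis by (simp add: power_add power_mult power_divide)
    qed
    also have "\<dots> < 1"
    proof -
      have "(2 * D) * k < q * k" using k kq by (intro mult_less_mono1) auto
      hence "2 * (D * k) < k * q" by (simp only: mult.assoc mult.commute[of q k])
      moreover have "(8 * l * K) * q \<le> k * q" using k by (intro mult_le_mono1) auto
      hence "8 * (l * q * K) \<le> k * q" by (simp only: mult_ac)
      ultimately have "D * k + 4 * (l * q * K) < k * q" by linarith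
      hence "(2 :: real) ^ (D * k + 4 * (l * q * K)) < 2 ^ (k * q)" by (intro power_strict_increasing) auto
      thus ?thesis by simp
    qed
    finally show "real p ^ (4 * l * k) * (2 * real B ^ k * (real B * a ^ (p ^ k)) ^ (2 * l * l * k)) *
     (real K * real (4 * l * l * k * B ^ k * p ^ (4 * l * k) * 16 ^ (l * p ^ k)) ^ K * real K ^ (6 * l * k * p ^ k)) < 1"
      unfolding S_def q_def .
  qed
qed

text \<open>The factor \<open>p ^ (4 * l * k)\<close> clears the denominators
  \<open>p ^ (2 * i)\<close>, \<open>i < 2 * l * k\<close>. Of the degree,
  \<open>2 * l * k * p ^ k\<close> stems from powers of \<alpha> and
  \<open>4 * l * k * p ^ k\<close> from powers of \<open>T p (\<alpha> ^ (p ^ k))\<close>, using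
  \<open>Suc k \<le> 2 * k\<close>.\<close>

lemma rep_peval_T:
  assumes p: "p \<ge> 2" and \<alpha>: "norm \<alpha> < 1" and k: "k \<ge> 1"
    and deg: "degree P < 2 * l" "\<And>j i. i \<ge> 2 * l * k \<Longrightarrow> coeff (coeff P j) i = 0"
    and coeffs: "\<And>j i. \<bar>coeff (coeff P j) i\<bar> \<le> int B ^ k"
  shows "rep \<alpha> (T p \<alpha>) (6 * l * k * p ^ k) (4 * l * l * k * B ^ k * p ^ (4 * l * k) * 16 ^ (l * p ^ k))
    (of_nat p ^ (4 * l * k) * peval P (\<alpha> ^ (p ^ k) / of_nat p ^ 2) (T p (\<alpha> ^ (p ^ k))))"
proof -
  define q where "q = p ^ k"
  define N where "N = 2 * l * k"
  define y where "y = T p (\<alpha> ^ q)"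
  define S where "S = B ^ k * p ^ (2 * N) * 16 ^ (l * q)"
  let ?p = "of_nat p :: complex"
  have p0: "?p \<noteq> 0" using p by simp
  have pe: "peval P u y = (\<Sum>j<2 * l. \<Sum>i<N. of_int (coeff (coeff P j) i) * u ^ i * y ^ j)" for u
    by (rule peval_altdef) (use deg in \<open>auto simp: N_def\<close>)
  have "of_nat p ^ (2 * N) * peval P (\<alpha> ^ q / of_nat p ^ 2) y =
      (\<Sum>j<2 * l. \<Sum>i<N. of_int (coeff (coeff P j) i * int p ^ (2 * (N - i))) * (1 * \<alpha> ^ (q * i) * T p \<alpha> ^ 0) * y ^ j)"
    unfolding pe sum_distrib_left
  proof (intro sum.cong refl)
    fix i j assume "i \<in> {..<N}"
    hence "?p ^ (2 * N) = ?p ^ (2 * (N - i)) * (?p ^ 2) ^ i"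
      unfolding power_mult[symmetric] power_add[symmetric] by (intro arg_cong[of _ _ "(^) ?p"]) auto
    thus "?p ^ (2 * N) * (of_int (coeff (coeff P j) i) * (\<alpha> ^ q / ?p ^ 2) ^ i * y ^ j) =
       of_int (coeff (coeff P j) i * int p ^ (2 * (N - i))) * (1 * \<alpha> ^ (q * i) * T p \<alpha> ^ 0) * y ^ j"
      using p0 by (simp add: power_divide power_mult)
  qed
  moreover have "rep \<alpha> (T p \<alpha>) (6 * l * k * q) (\<Sum>j<2 * l. \<Sum>i<N. S)
      (\<Sum>j<2 * l. \<Sum>i<N. of_int (coeff (coeff P j) i * int p ^ (2 * (N - i))) * (1 * \<alpha> ^ (q * i) * T p \<alpha> ^ 0) * y ^ j)"
  proof (intro rep_sum finite_lessThan)
    fix i j assume ij: "j \<in> {..<2 * l}" "i \<in> {..<N}"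
    define n where "n = coeff (coeff P j) i * int p ^ (2 * (N - i))"
    have y: "rep \<alpha> (T p \<alpha>) (j * (Suc k * q)) ((2 ^ (2 * q - 1)) ^ j) (y ^ j)"
      unfolding y_def q_def by (intro rep_power rep_T_power p \<alpha>)
    have "rep \<alpha> (T p \<alpha>) (0 + q * i + j * (Suc k * q)) (nat \<bar>n\<bar> * 1 * (2 ^ (2 * q - 1)) ^ j)
        (of_int n * (1 * \<alpha> ^ (q * i) * T p \<alpha> ^ 0) * y ^ j)"
      by (intro rep_mult rep_of_int rep_monomial y) auto
    thus "rep \<alpha> (T p \<alpha>) (6 * l * k * q) S (of_int n * (1 * \<alpha> ^ (q * i) * T p \<alpha> ^ 0) * y ^ j)"
    proof (rule rep_mono)
      have "q * i \<le> q * N" using ij by simp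
      moreover have "j * (Suc k * q) \<le> (2 * l) * ((2 * k) * q)" using ij k by (intro mult_le_mono) auto
      moreover have "q * N = 2 * (l * k * q)" "(2 * l) * ((2 * k) * q) = 4 * (l * k * q)" "6 * l * k * q = 6 * (l * k * q)"
        by (simp_all add: N_def)
      ultimately show "0 + q * i + j * (Suc k * q) \<le> 6 * l * k * q" by linarith
      have "\<bar>n\<bar> \<le> int B ^ k * int p ^ (2 * N)"
        unfolding n_def abs_mult using coeffs p by (intro mult_mono) (auto intro!: power_increasing)
      hence "nat \<bar>n\<bar> \<le> B ^ k * p ^ (2 * N)" by (simp add: nat_le_iff)
      moreover have "(2 ^ (2 * q - 1)) ^ j \<le> (16 :: nat) ^ (l * q)"
      proof -
        have "(2 * q - 1) * j \<le> (2 * q) * (2 * l)" using ij by (intro mult_le_mono) auto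
        hence "(2 :: nat) ^ ((2 * q - 1) * j) \<le> 2 ^ (4 * (l * q))" by (intro power_increasing) (auto simp: algebra_simps)
        thus ?thesis by (simp add: power_mult)
      qed
      ultimately show "nat \<bar>n\<bar> * 1 * (2 ^ (2 * q - 1)) ^ j \<le> S" unfolding S_def by (simp add: mult_le_mono)
    qed
  qed
  moreover have "(\<Sum>j<2 * l. \<Sum>i<N. S) = 4 * l * l * k * B ^ k * p ^ (4 * l * k) * 16 ^ (l * q)"
    by (simp add: S_def N_def mult.assoc)
  moreover have "2 * N = 4 * l * k" by (simp add: N_def)
  ultimately show ?thesis by (simp only: y_def q_def)
qed

lemma eventually_poly_less_exp:
  "\<exists>k0. \<forall>k\<ge>k0. W * (k * k) < (2 :: nat) ^ k"
proof -
  have "eventually (\<lambda>k. real W * (real k * real k) < 2 ^ k) at_top" by real_asymp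
  then obtain k0 where "\<And>k. k \<ge> k0 \<Longrightarrow> real W * (real k * real k) < 2 ^ k"
    by (auto simp: eventually_at_top_linorder)
  hence "real (W * (k * k)) < real (2 ^ k)" if "k \<ge> k0" for k using that by simp
  thus ?thesis by (meson of_nat_less_iff)
qed

text \<open>The lowest coefficient is a non-zero integer, so its term must be balanced by a tail
  containing one more factor \<open>x\<close>. For tiny \<open>x\<close> this is possible only if
  the order is large.\<close>

lemma order_bound_if_sum_zero:
  fixes f :: "int fps" and x :: complex
  assumes sums: "(\<lambda>n. of_int (f $ n) * x ^ n) sums 0" and f: "f \<noteq> 0"
    and bound: "\<And>n. \<bar>f $ n\<bar> \<le> int B ^ (k + n)" and x: "x \<noteq> 0" "real B * norm x \<le> 1 / 2"
  shows "1 \<le> 2 * real B ^ (k + subdegree f + 1) * norm x"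
proof -
  define M where "M = subdegree f"
  define g where "g = (\<lambda>n. if n = M then 0 else of_int (f $ n) :: complex)"
  have "(\<lambda>n. of_int (f $ n) * x ^ n - (if n = M then of_int (f $ M) * x ^ M else 0)) sums (0 - of_int (f $ M) * x ^ M)"
    by (intro sums_diff sums sums_single)
  moreover have "(\<lambda>n. of_int (f $ n) * x ^ n - (if n = M then of_int (f $ M) * x ^ M else 0)) = (\<lambda>n. g n * x ^ n)"
    by (auto simp: g_def)
  ultimately have gs: "(\<lambda>n. g n * x ^ n) sums (- (of_int (f $ M) * x ^ M))" by simp
  have bR: "norm (of_int (f $ n) :: complex) \<le> real B ^ k * real B ^ n" for n
  proof -
    have "real_of_int \<bar>f $ n\<bar> \<le> real_of_int (int B ^ (k + n))" using bound[of n] by (simp only: of_int_le_iff)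
    thus ?thesis by (simp add: power_add)
  qed
  have "norm (- (of_int (f $ M) * x ^ M)) \<le> 2 * real B ^ k * (real B * norm x) ^ Suc M"
  proof (rule norm_power_series_le[OF gs])
    show "g n = 0" if "n < Suc M" for n using that by (auto simp: g_def M_def less_Suc_eq nth_less_subdegree_zero)
    show "norm (g n) \<le> real B ^ k * real B ^ n" for n using bR[of n] by (auto simp: g_def)
  qed (use x in auto)
  moreover have "1 \<le> norm (of_int (f $ M) :: complex)"
  proof -
    have "f $ M \<noteq> 0" using f by (simp add: M_def)
    hence "1 \<le> \<bar>f $ M\<bar>" by linarith
    hence "1 \<le> real_of_int \<bar>f $ M\<bar>" by linarith
    thus ?thesis by simp
  qed
  hence "1 * norm x ^ M \<le> norm (- (of_int (f $ M) * x ^ M))"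
    unfolding norm_minus_cancel norm_mult norm_power by (intro mult_right_mono) auto
  ultimately have "1 * norm x ^ M \<le> (2 * real B ^ (k + M + 1) * norm x) * norm x ^ M"
    by (simp add: power_mult_distrib power_add algebra_simps)
  thus ?thesis using x unfolding M_def by (subst (asm) mult_le_cancel_right) auto
qed

theorem theorem1p1:
  fixes p :: nat and \<alpha> :: complex
  assumes "prime p" and "algebraic \<alpha>" and "\<alpha> \<noteq> 0" and "norm \<alpha> < 1"
  shows "\<not> algebraic (T p \<alpha>)"
proof
  assume alg: "algebraic (T p \<alpha>)"
  have p: "p \<ge> 2" using assms(1) by (rule prime_ge_2_nat)
  define a where "a = norm \<alpha>"
  have a: "0 < a" "a < 1" using assms by (auto simp: a_def)
  obtain F C where rad: "fps_conv_radius (cfps F) \<ge> ereal (1 / real p ^ 2)"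
    and eval: "\<And>x. norm x < 1 / real p ^ 2 \<Longrightarrow> eval_fps (cfps F) x = T p (of_nat p ^ 2 * x)"
    and FC: "\<And>n. \<bar>F $ n\<bar> \<le> int C ^ Suc n"
    by (rule T_integral_expansion[OF p], rule that)
  interpret transcendental_fps F by (rule T_integral_expansion_transcendental[OF p rad eval])
  obtain K where K: "K \<ge> 1" "\<And>d S x. rep \<alpha> (T p \<alpha>) d S x \<Longrightarrow> S \<ge> 1 \<Longrightarrow> x \<noteq> 0 \<Longrightarrow> norm x \<le> 1 \<Longrightarrow>
       1 \<le> norm x * (real K * real S ^ K * real K ^ d)"
    by (rule liouville_inequality[OF assms(2) alg], rule that)
  \<comment> \<open>\<open>K\<close> depends only on \<alpha> and \<open>T p \<alpha>\<close>, so
    \<open>l\<close> may be chosen after it; the constants \<open>B\<close> and the bounds for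
    \<open>k\<close> come later still.\<close>
  obtain l where l: "l \<ge> 1" "real K ^ 6 * a ^ (2 * l) \<le> 1 / 2"
  proof -
    have "1 / (2 * real K ^ 6) > 0" using K by simp
    then obtain n where n: "a ^ n < 1 / (2 * real K ^ 6)" using real_arch_pow_inv a by blast
    have "a ^ (2 * Suc n) \<le> a ^ n" using a by (intro power_decreasing) auto
    hence "real K ^ 6 * a ^ (2 * Suc n) \<le> real K ^ 6 * (1 / (2 * real K ^ 6))"
      using n by (intro mult_left_mono) auto
    thus ?thesis using K by (intro that[of "Suc n"]) auto
  qed
  define good where "good = (\<lambda>B k P. P \<noteq> 0 \<and> degree P < 2 * l \<and>
       (\<forall>j i. i \<ge> 2 * l * k \<longrightarrow> coeff (coeff P j) i = 0) \<and>
       (\<forall>j i. \<bar>coeff (coeff P j) i\<bar> \<le> int B ^ k) \<and> (\<forall>m < 2 * l * l * k. ev F P $ m = 0) \<and>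
       (\<forall>m. \<bar>ev F P $ m\<bar> \<le> int B ^ (k + m)))"
  have "\<exists>B\<ge>2. \<forall>k\<ge>1. \<exists>P. good B k P"
    unfolding good_def by (rule auxiliary_polynomial[OF FC l(1)])
  then obtain B where B: "B \<ge> 2" "\<And>k. k \<ge> 1 \<Longrightarrow> \<exists>P. good B k P" by blast
  define P where "P = (\<lambda>k. SOME P. good B k P)"
  have goodP: "good B k (P k)" if "k \<ge> 1" for k
    unfolding P_def by (rule someI_ex[OF B(2)[OF that]])
  have P: "\<And>k. k \<ge> 1 \<Longrightarrow> P k \<noteq> 0" "\<And>k. k \<ge> 1 \<Longrightarrow> degree (P k) < 2 * l"
    "\<And>k j i. k \<ge> 1 \<Longrightarrow> i \<ge> 2 * l * k \<Longrightarrow> coeff (coeff (P k) j) i = 0"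
    "\<And>k j i. k \<ge> 1 \<Longrightarrow> \<bar>coeff (coeff (P k) j) i\<bar> \<le> int B ^ k"
    "\<And>k m. k \<ge> 1 \<Longrightarrow> m < 2 * l * l * k \<Longrightarrow> ev F (P k) $ m = 0"
    "\<And>k m. k \<ge> 1 \<Longrightarrow> \<bar>ev F (P k) $ m\<bar> \<le> int B ^ (k + m)"
    using goodP unfolding good_def by blast+
  define x where "x = (\<lambda>k. \<alpha> ^ (p ^ k) / of_nat p ^ 2)"
  have x: "x k \<noteq> 0" "norm (x k) \<le> a ^ (p ^ k)" "norm (x k) < 1 / real p ^ 2" for k
  proof -
    show "x k \<noteq> 0" using assms p by (simp add: x_def)
    have n: "norm (x k) = a ^ (p ^ k) / real p ^ 2" by (simp add: x_def norm_divide norm_power a_def)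
    show "norm (x k) \<le> a ^ (p ^ k)" unfolding n using p a by (simp add: divide_le_eq mult_le_cancel_left1 one_le_power)
    have "a ^ (p ^ k) < 1" using a p power_less_one_iff[of a "p ^ k"] by simp
    thus "norm (x k) < 1 / real p ^ 2" unfolding n using p by (intro divide_strict_right_mono) auto
  qed
  have val_sums: "(\<lambda>n. of_int (ev F (P k) $ n) * x k ^ n) sums peval (P k) (x k) (T p (\<alpha> ^ (p ^ k)))" for k
  proof -
    have "ereal (norm (x k)) < fps_conv_radius (cfps F)"
      using x(3)[of k] rad by (auto intro: less_le_trans[of _ "ereal (1 / real p ^ 2)"])
    from sums_ev[OF this] have "(\<lambda>n. of_int (ev F (P k) $ n) * x k ^ n) sums peval (P k) (x k) (eval_fps (cfps F) (x k))" .
    moreover have "eval_fps (cfps F) (x k) = T p (\<alpha> ^ (p ^ k))"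
      using eval[OF x(3)[of k]] p by (simp add: x_def)
    ultimately show ?thesis by simp
  qed
  obtain k1 where k1: "a ^ k1 < 1 / (2 * real B)" using real_arch_pow_inv[of "1 / (2 * real B)" a] a B by auto
  have Bx: "real B * norm (x k) \<le> 1 / 2" if "k \<ge> k1" for k
  proof -
    have "k < 2 ^ k" by (rule less_exp)
    also have "\<dots> \<le> p ^ k" using p by (intro power_mono) auto
    finally have "a ^ (p ^ k) \<le> a ^ k1" using a that by (intro power_decreasing) auto
    hence "norm (x k) \<le> 1 / (2 * real B)" using x(2)[of k] k1 by linarith
    thus ?thesis using B by (simp add: field_simps)
  qed
  obtain k2 where k2: "\<And>k. k \<ge> k2 \<Longrightarrow> real p ^ (4 * l * k) * (2 * real B ^ k * (real B * a ^ (p ^ k)) ^ (2 * l * l * k)) *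
     (real K * real (4 * l * l * k * B ^ k * p ^ (4 * l * k) * 16 ^ (l * p ^ k)) ^ K * real K ^ (6 * l * k * p ^ k)) < 1"
    using eventually_below_liouville_bound[OF a K(1) _ p l, of B] B by auto
  have vanish: "peval (P k) (x k) (T p (\<alpha> ^ (p ^ k))) = 0" if k: "k \<ge> 1" "k \<ge> k1" "k \<ge> k2" for k
  proof (rule ccontr)
    let ?E = "peval (P k) (x k) (T p (\<alpha> ^ (p ^ k)))"
    define \<xi> where "\<xi> = of_nat p ^ (4 * l * k) * ?E"
    define S where "S = 4 * l * l * k * B ^ k * p ^ (4 * l * k) * 16 ^ (l * p ^ k)"
    define Y where "Y = real K * real S ^ K * real K ^ (6 * l * k * p ^ k)"
    assume "?E \<noteq> 0"
    hence "\<xi> \<noteq> 0" using p by (simp add: \<xi>_def)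
    have S1: "S \<ge> 1" using l k B p by (simp add: S_def)
    have "real K ^ i \<ge> 1" "real S ^ i \<ge> 1" for i using K S1 by (auto intro: one_le_power)
    hence Y1: "Y \<ge> 1 * 1 * 1" unfolding Y_def using K by (intro mult_mono) auto
    have rep: "rep \<alpha> (T p \<alpha>) (6 * l * k * p ^ k) S \<xi>"
      unfolding S_def \<xi>_def x_def using P k by (intro rep_peval_T p assms) auto
    have "norm ?E \<le> 2 * real B ^ k * (real B * norm (x k)) ^ (2 * l * l * k)"
    proof (rule norm_power_series_le[OF val_sums])
      show "norm (of_int (ev F (P k) $ n) :: complex) \<le> real B ^ k * real B ^ n" for n
      proof -
        have "real_of_int \<bar>ev F (P k) $ n\<bar> \<le> real_of_int (int B ^ (k + n))"
          using P(6)[OF k(1), of n] by (simp only: of_int_le_iff)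
        thus ?thesis by (simp add: power_add)
      qed
    qed (use P(5) k Bx in auto)
    also have "\<dots> \<le> 2 * real B ^ k * (real B * a ^ (p ^ k)) ^ (2 * l * l * k)"
      using x(2)[of k] by (intro mult_left_mono power_mono) auto
    finally have "norm \<xi> \<le> real p ^ (4 * l * k) * (2 * real B ^ k * (real B * a ^ (p ^ k)) ^ (2 * l * l * k))"
      unfolding \<xi>_def norm_mult norm_power norm_of_nat by (intro mult_left_mono) auto
    hence "norm \<xi> * Y \<le> real p ^ (4 * l * k) * (2 * real B ^ k * (real B * a ^ (p ^ k)) ^ (2 * l * l * k)) * Y"
      using Y1 by (intro mult_right_mono) auto
    hence less: "norm \<xi> * Y < 1" using k2[OF k(3)] unfolding Y_def S_def by linarith
    have "norm \<xi> * 1 \<le> norm \<xi> * Y" using Y1 by (intro mult_left_mono) auto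
    hence "norm \<xi> \<le> 1" using less by simp
    from K(2)[OF rep S1 \<open>\<xi> \<noteq> 0\<close> this] less show False unfolding Y_def by linarith
  qed
  \<comment> \<open>\<open>s\<close> converts powers of \<open>B\<close> into powers of
    \<open>a\<close>: once \<open>p ^ k\<close> exceeds \<open>s * (k + M + 2)\<close>, the product
    \<open>B ^ (k + M + 2) * a ^ (p ^ k)\<close> falls below 1.\<close>
  obtain s where s: "a ^ s < 1 / real B" using real_arch_pow_inv[of "1 / real B" a] a B by auto
  define Z where "Z = 2 ^ (2 * (2 * l)) * (2 * (2 * l))"
  \<comment> \<open>If the order \<open>M\<close> were at most \<open>Z * (4 * l) * k ^ 2\<close>,
    then \<open>k + M + 2\<close> would be at most \<open>(3 + Z * (4 * l)) * k ^ 2\<close>, which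
    \<open>2 ^ k\<close> outgrows even after multiplication by \<open>s\<close>.\<close>
  define W where "W = s * (3 + Z * (4 * l))"
  obtain k3 where k3: "\<And>k. k \<ge> k3 \<Longrightarrow> W * (k * k) < 2 ^ k" using eventually_poly_less_exp by blast
  define k0 where "k0 = Max {1, k1, k2, k3}"
  have k0: "k0 \<ge> 1" "k0 \<ge> k1" "k0 \<ge> k2" "k0 \<ge> k3" by (auto simp: k0_def)
  have large: "Z * k * (2 * l * k + 2 * l) < vord (P k)" if "k \<ge> k0" for k
  proof (rule ccontr)
    assume "\<not> ?thesis"
    hence M: "vord (P k) \<le> Z * k * (2 * l * k + 2 * l)" by simp
    have k: "k \<ge> 1" "k \<ge> k1" "k \<ge> k2" "k \<ge> k3" using that k0 by auto
    define M where "M = vord (P k)"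
    have "1 \<le> 2 * real B ^ (k + M + 1) * norm (x k)"
      unfolding M_def vord_def
      by (rule order_bound_if_sum_zero) (use val_sums[of k] vanish[of k] ev_nonzero P k x Bx in auto)
    also have "\<dots> \<le> real B * real B ^ (k + M + 1) * a ^ (p ^ k)"
      using B x(2)[of k] by (intro mult_mono) auto
    finally have 1: "1 \<le> real B ^ (k + M + 2) * a ^ (p ^ k)" by simp
    have "s * (k + M + 2) < p ^ k"
    proof -
      have "2 * l * k + 2 * l \<le> 4 * l * k" using k by simp
      hence "Z * k * (2 * l * k + 2 * l) \<le> Z * k * (4 * l * k)" by (intro mult_le_mono2)
      also have "\<dots> = Z * (4 * l) * (k * k)" by (simp only: mult_ac)
      finally have "M \<le> Z * (4 * l) * (k * k)" using M unfolding M_def by linarith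
      moreover have "k \<le> k * k" "2 \<le> 2 * (k * k)" using k by auto
      ultimately have "k + M + 2 \<le> (3 + Z * (4 * l)) * (k * k)"
        unfolding distrib_right by linarith
      hence "s * (k + M + 2) \<le> W * (k * k)" unfolding W_def mult.assoc by (intro mult_le_mono2)
      also have "\<dots> < 2 ^ k" using k3 k by simp
      also have "\<dots> \<le> p ^ k" using p by (intro power_mono) auto
      finally show ?thesis .
    qed
    hence "a ^ (p ^ k) \<le> a ^ (s * (k + M + 2))" using a by (intro power_decreasing) auto
    also have "\<dots> = (a ^ s) ^ (k + M + 2)" by (rule power_mult)
    finally have "real B ^ (k + M + 2) * a ^ (p ^ k) \<le> (real B * a ^ s) ^ (k + M + 2)"
      unfolding power_mult_distrib by (intro mult_left_mono) auto
    also have "real B * a ^ s < 1" using s B by (simp add: field_simps)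
    hence "(real B * a ^ s) ^ (k + M + 2) < 1" using a power_less_one_iff[of "real B * a ^ s" "k + M + 2"] by simp
    finally show False using 1 by simp
  qed
  show False
  proof (rule order_not_too_large[of k0 P "2 * l" "2 * l"])
    fix k assume k: "k \<ge> k0"
    hence k': "k \<ge> 1" using k0 by simp
    have "degree (coeff (P k) i) \<le> 2 * l * k" for i
      using P(3)[OF k'] by (intro degree_le) auto
    hence "degz (P k) \<le> 2 * l * k" by (rule degz_le)
    thus "P k \<noteq> 0 \<and> degree (P k) \<le> 2 * l \<and> degz (P k) \<le> 2 * l * k" using P(1,2)[OF k'] by simp
    show "2 ^ (2 * (2 * l)) * (2 * (2 * l)) * k * (2 * l * k + 2 * l) < vord (P k)"
      using large[OF k] by (simp add: Z_def)
  qed (use l k0 in auto)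
qed

end
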